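(* Let $S=R[x;\sigma]$ where $\sigma$ is a ring endomorphism of $R$ and let $M$ be a right $R$-module, with induced right $S$-module $M[x;\sigma]=M\otimes_R S$. (1) $\operatorname{Ass} M[x;\sigma]=\{\,(\sigma^{-k}(J):\sigma)[x;\sigma]\mid k\in\mathbb{N}\text{ and } J\text{ is the annihilator of an } S\text{-prime submodule of } M_{\sigma^k}\,\}$. (2) If $\sigma$ is surjective, then $\operatorname{Ass} M[x;\sigma]=\{\,(J:\sigma)[x;\sigma]\mid J\text{ is the annihilator of an } S\text{-prime submodule of } M\,\}$. (3) If $R$ satisfies the ascending chain condition on (two-sided) ideals and $\sigma$ is an automorphism, then $\operatorname{Ass} M[x;\sigma]=\{\,(P:\sigma)[x;\sigma]\mid P\in\operatorname{Ass} M\,\}$.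
   Context: Rings have $1$, modules are unital right modules, ideals are two-sided, $\mathbb{N}$ is the set of nonnegative integers. $R[x;\sigma]$ is the skew polynomial ring with coefficients on the left and $xr=\sigma(r)x$. $M\otimes_R S$ is identified with $M[x;\sigma]=\bigoplus_{n\ge0}Mx^n$ (so $mx^n\cdot r=m\sigma^n(r)x^n$); for an ideal $I$ of $R$, $I[x;\sigma]=IS$. For $X\subseteq R$, $(X:\sigma)=\bigcap_{n\ge0}\sigma^{-n}(X)=\{r\in R:\sigma^n(r)\in X\text{ for all }n\in\mathbb{N}\}$. $M_{\sigma^k}$ is the $R$-module with the same additive group as $M$ and action $m*r=m\sigma^k(r)$; its submodules are $R$-submodules for this action and their annihilators are taken in $R$ for this action. A nonzero module is prime if all its nonzero submodules have the same annihilator as the module itself. $\operatorname{Ass}$ of a module is the set of annihilators of its prime submodules. A right $R$-module $L$ is $S$-prime if the right $S$-module $L\otimes_R S$ is prime. *)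

theory Defs
  imports "HOL-Algebra.QuotRing" "HOL-Algebra.UnivPoly"
begin

text \<open>
  HOL-Algebra's \<open>module\<close> is a left module over a commutative ring, so right modules over an
  arbitrary ring are set up here. As there, the additive group is an \<open>abelian_group\<close>, i.e. it
  lives in a ring record whose \<open>mult\<close> and \<open>one\<close> fields are irrelevant.
\<close>

record ('a, 'b) right_module = "'b ring" +
  ract :: "'b \<Rightarrow> 'a \<Rightarrow> 'b" (infixl \<open>\<cdot>\<index>\<close> 70)

locale right_module = R?: ring R + M?: abelian_group M
  for R (structure) and M :: "('a, 'b, 'm) right_module_scheme" (structure) +
  assumes ract_closed:
      "\<lbrakk>m \<in> carrier M; r \<in> carrier R\<rbrakk> \<Longrightarrow> m \<cdot>\<^bsub>M\<^esub> r \<in> carrier M"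
    and ract_l_distr:
      "\<lbrakk>m \<in> carrier M; m' \<in> carrier M; r \<in> carrier R\<rbrakk>
        \<Longrightarrow> (m \<oplus>\<^bsub>M\<^esub> m') \<cdot>\<^bsub>M\<^esub> r = m \<cdot>\<^bsub>M\<^esub> r \<oplus>\<^bsub>M\<^esub> m' \<cdot>\<^bsub>M\<^esub> r"
    and ract_r_distr:
      "\<lbrakk>m \<in> carrier M; r \<in> carrier R; s \<in> carrier R\<rbrakk>
        \<Longrightarrow> m \<cdot>\<^bsub>M\<^esub> (r \<oplus>\<^bsub>R\<^esub> s) = m \<cdot>\<^bsub>M\<^esub> r \<oplus>\<^bsub>M\<^esub> m \<cdot>\<^bsub>M\<^esub> s"
    and ract_assoc:
      "\<lbrakk>m \<in> carrier M; r \<in> carrier R; s \<in> carrier R\<rbrakk>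
        \<Longrightarrow> m \<cdot>\<^bsub>M\<^esub> (r \<otimes>\<^bsub>R\<^esub> s) = (m \<cdot>\<^bsub>M\<^esub> r) \<cdot>\<^bsub>M\<^esub> s"
    and ract_one:
      "m \<in> carrier M \<Longrightarrow> m \<cdot>\<^bsub>M\<^esub> \<one>\<^bsub>R\<^esub> = m"

definition right_submodule ::
    "'b set \<Rightarrow> ('a, 'c) ring_scheme \<Rightarrow> ('a, 'b, 'm) right_module_scheme \<Rightarrow> bool" where
  "right_submodule N R M \<longleftrightarrow>
     additive_subgroup N M \<and> (\<forall>m\<in>N. \<forall>r\<in>carrier R. m \<cdot>\<^bsub>M\<^esub> r \<in> N)"

definition annihilator ::
    "('a, 'c) ring_scheme \<Rightarrow> ('a, 'b, 'm) right_module_scheme \<Rightarrow> 'a set" where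
  "annihilator R M = {r \<in> carrier R. \<forall>m\<in>carrier M. m \<cdot>\<^bsub>M\<^esub> r = \<zero>\<^bsub>M\<^esub>}"

text \<open>A submodule \<open>N\<close> of \<open>M\<close> is turned into a module of its own as \<open>M\<lparr>carrier := N\<rparr>\<close>.\<close>

definition prime_module ::
    "('a, 'c) ring_scheme \<Rightarrow> ('a, 'b, 'm) right_module_scheme \<Rightarrow> bool" where
  "prime_module R M \<longleftrightarrow>
     carrier M \<noteq> {\<zero>\<^bsub>M\<^esub>} \<and>
     (\<forall>N. right_submodule N R M \<and> N \<noteq> {\<zero>\<^bsub>M\<^esub>} \<longrightarrow>
        annihilator R (M\<lparr>carrier := N\<rparr>) = annihilator R M)"

definition Ass ::
    "('a, 'c) ring_scheme \<Rightarrow> ('a, 'b, 'm) right_module_scheme \<Rightarrow> 'a set set" where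
  "Ass R M = {annihilator R (M\<lparr>carrier := N\<rparr>) | N.
     right_submodule N R M \<and> prime_module R (M\<lparr>carrier := N\<rparr>)}"

text \<open>
  \<open>R[x;\<sigma>]\<close>: a polynomial with left coefficients \<open>\<Sum> a\<^sub>n x\<^sup>n\<close> is its coefficient sequence
  \<open>n \<mapsto> a\<^sub>n\<close>. The rule \<open>x r = \<sigma>(r) x\<close> gives \<open>(a x\<^sup>i)(b x\<^sup>j) = a \<sigma>\<^sup>i(b) x\<^bsup>i+j\<^esup>\<close>.
  The set \<open>up\<close> from UnivPoly consists of the finitely supported sequences in the carrier.
\<close>

definition skew_poly_ring ::
    "('a, 'c) ring_scheme \<Rightarrow> ('a \<Rightarrow> 'a) \<Rightarrow> (nat \<Rightarrow> 'a) ring" where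
  "skew_poly_ring R \<sigma> =
    \<lparr>carrier = up R,
     mult = (\<lambda>f g n. \<Oplus>\<^bsub>R\<^esub>i\<in>{..n}. f i \<otimes>\<^bsub>R\<^esub> (\<sigma> ^^ i) (g (n - i))),
     one = (\<lambda>n. if n = 0 then \<one>\<^bsub>R\<^esub> else \<zero>\<^bsub>R\<^esub>),
     zero = (\<lambda>n. \<zero>\<^bsub>R\<^esub>),
     add = (\<lambda>f g n. f n \<oplus>\<^bsub>R\<^esub> g n)\<rparr>"

text \<open>
  \<open>M[x;\<sigma>] = M \<otimes>\<^sub>R R[x;\<sigma>]\<close>, in the same encoding, with
  \<open>(m x\<^sup>i)(r x\<^sup>j) = m \<sigma>\<^sup>i(r) x\<^bsup>i+j\<^esup>\<close>.
\<close>

definition skew_poly_module ::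
    "('a, 'b, 'm) right_module_scheme \<Rightarrow> ('a \<Rightarrow> 'a) \<Rightarrow> (nat \<Rightarrow> 'a, nat \<Rightarrow> 'b) right_module" where
  "skew_poly_module M \<sigma> =
    \<lparr>carrier = up M,
     mult = undefined,
     one = undefined,
     zero = (\<lambda>n. \<zero>\<^bsub>M\<^esub>),
     add = (\<lambda>f g n. f n \<oplus>\<^bsub>M\<^esub> g n),
     ract = (\<lambda>f g n. \<Oplus>\<^bsub>M\<^esub>i\<in>{..n}. f i \<cdot>\<^bsub>M\<^esub> (\<sigma> ^^ i) (g (n - i)))\<rparr>"

text \<open>\<open>I[x;\<sigma>]\<close>, as a subset of \<open>R[x;\<sigma>]\<close>.\<close>

definition skew_poly_ideal :: "('a, 'c) ring_scheme \<Rightarrow> 'a set \<Rightarrow> (nat \<Rightarrow> 'a) set" where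
  "skew_poly_ideal R I = {f \<in> up R. \<forall>n. f n \<in> I}"

text \<open>\<open>M\<^bsub>\<sigma>\<^sup>k\<^esub>\<close>\<close>

definition twist ::
    "('a \<Rightarrow> 'a) \<Rightarrow> nat \<Rightarrow> ('a, 'b, 'm) right_module_scheme \<Rightarrow> ('a, 'b, 'm) right_module_scheme" where
  "twist \<sigma> k M = M\<lparr>ract := \<lambda>m r. m \<cdot>\<^bsub>M\<^esub> (\<sigma> ^^ k) r\<rparr>"

definition S_prime ::
    "('a, 'c) ring_scheme \<Rightarrow> ('a \<Rightarrow> 'a) \<Rightarrow> ('a, 'b, 'm) right_module_scheme \<Rightarrow> bool" where
  "S_prime R \<sigma> L \<longleftrightarrow> prime_module (skew_poly_ring R \<sigma>) (skew_poly_module L \<sigma>)"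

definition S_prime_annihilators ::
    "('a, 'c) ring_scheme \<Rightarrow> ('a \<Rightarrow> 'a) \<Rightarrow> ('a, 'b, 'm) right_module_scheme \<Rightarrow> 'a set set" where
  "S_prime_annihilators R \<sigma> M = {annihilator R (M\<lparr>carrier := N\<rparr>) | N.
     right_submodule N R M \<and> S_prime R \<sigma> (M\<lparr>carrier := N\<rparr>)}"

text \<open>\<open>\<sigma>\<^sup>-\<^sup>k(X)\<close> and \<open>(X : \<sigma>)\<close>, where preimages are taken in the carrier of \<open>R\<close>.\<close>

definition pow_preimage ::
    "('a, 'c) ring_scheme \<Rightarrow> ('a \<Rightarrow> 'a) \<Rightarrow> nat \<Rightarrow> 'a set \<Rightarrow> 'a set" where
  "pow_preimage R \<sigma> k X = {r \<in> carrier R. (\<sigma> ^^ k) r \<in> X}"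

definition sigma_core ::
    "('a, 'c) ring_scheme \<Rightarrow> ('a \<Rightarrow> 'a) \<Rightarrow> 'a set \<Rightarrow> 'a set" where
  "sigma_core R \<sigma> X = (\<Inter>n. pow_preimage R \<sigma> n X)"

definition acc_on_ideals :: "('a, 'c) ring_scheme \<Rightarrow> bool" where
  "acc_on_ideals R \<longleftrightarrow>
     (\<forall>I :: nat \<Rightarrow> 'a set. (\<forall>n. ideal (I n) R) \<and> (\<forall>n. I n \<subseteq> I (Suc n)) \<longrightarrow>
        (\<exists>N. \<forall>n\<ge>N. I n = I N))"

end

theory Submission
  imports Defs
begin

text \<open>
  Let \<open>f\<close> be a nonzero element of least support size in a prime submodule of \<open>M[x;\<sigma>]\<close>, with lowest
  term \<open>m x\<^sup>k\<close>. By minimality \<open>m \<sigma>\<^sup>k(r) = 0\<close> forces \<open>f r = 0\<close>, so \<open>f S\<close> is isomorphic to \<open>L \<otimes> S\<close>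
  for \<open>L = m \<sigma>\<^sup>k(R) \<subseteq> M\<^bsub>\<sigma>\<^sup>k\<^esub>\<close>, and \<open>L\<close> is \<open>S\<close>-prime. Conversely \<open>L \<otimes> S\<close> embeds in \<open>M[x;\<sigma>]\<close> by
  multiplication with \<open>x\<^sup>k\<close>. As \<open>J\<close> is already the annihilator for the twisted action, the ideal that
  arises is \<open>(J : \<sigma>)[x;\<sigma>]\<close>; it equals \<open>(\<sigma>\<^sup>-\<^sup>k(J) : \<sigma>)[x;\<sigma>]\<close> because \<open>L x\<^sup>k S\<close> is a nonzero
  submodule of the prime module \<open>L \<otimes> S\<close>. If \<open>\<sigma>\<close> is surjective, so is \<open>\<sigma>\<^sup>k\<close> on \<open>S\<close>, and twisting
  does not affect \<open>S\<close>-primeness. Under the chain condition the chain \<open>\<sigma>\<^sup>-\<^sup>n((P : \<sigma>))\<close> stabilises, whence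
  \<open>(P : \<sigma>) = \<sigma>\<^sup>-\<^sup>d((P : \<sigma>))\<close>; comparing leading coefficients then shows that prime modules are
  \<open>S\<close>-prime.
\<close>

section \<open>Prime modules and semilinear embeddings\<close>

context right_module
begin

lemma ract_zero:
  assumes "m \<in> carrier M" shows "m \<cdot>\<^bsub>M\<^esub> \<zero>\<^bsub>R\<^esub> = \<zero>\<^bsub>M\<^esub>"
proof -
  have "m \<cdot>\<^bsub>M\<^esub> \<zero>\<^bsub>R\<^esub> \<oplus>\<^bsub>M\<^esub> m \<cdot>\<^bsub>M\<^esub> \<zero>\<^bsub>R\<^esub> = m \<cdot>\<^bsub>M\<^esub> \<zero>\<^bsub>R\<^esub>"
    using ract_r_distr[OF assms R.zero_closed R.zero_closed] by simp
  then show ?thesis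
    using assms ract_closed M.add.l_cancel_one by simp
qed

lemma zero_ract:
  assumes "r \<in> carrier R" shows "\<zero>\<^bsub>M\<^esub> \<cdot>\<^bsub>M\<^esub> r = \<zero>\<^bsub>M\<^esub>"
proof -
  have "\<zero>\<^bsub>M\<^esub> \<cdot>\<^bsub>M\<^esub> r \<oplus>\<^bsub>M\<^esub> \<zero>\<^bsub>M\<^esub> \<cdot>\<^bsub>M\<^esub> r = \<zero>\<^bsub>M\<^esub> \<cdot>\<^bsub>M\<^esub> r"
    using ract_l_distr[OF M.zero_closed M.zero_closed assms] by simp
  then show ?thesis
    using assms ract_closed M.add.l_cancel_one by simp
qed

lemma ract_neg_one:
  assumes "m \<in> carrier M" shows "m \<cdot>\<^bsub>M\<^esub> (\<ominus>\<^bsub>R\<^esub> \<one>\<^bsub>R\<^esub>) = \<ominus>\<^bsub>M\<^esub> m"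
proof (rule M.minus_equality[symmetric])
  show "m \<cdot>\<^bsub>M\<^esub> (\<ominus>\<^bsub>R\<^esub> \<one>\<^bsub>R\<^esub>) \<oplus>\<^bsub>M\<^esub> m = \<zero>\<^bsub>M\<^esub>"
    using ract_r_distr[OF assms, of "\<ominus>\<^bsub>R\<^esub> \<one>\<^bsub>R\<^esub>" "\<one>\<^bsub>R\<^esub>"] assms
    by (simp add: ract_one ract_zero R.l_neg)
qed (use assms ract_closed in auto)

text \<open>Closure under negation comes from the action of minus one, by
  \<open>ract_neg_one\<close>.\<close>

lemma right_submoduleI:
  assumes "N \<subseteq> carrier M" "\<zero>\<^bsub>M\<^esub> \<in> N"
    and "\<And>m n. \<lbrakk>m \<in> N; n \<in> N\<rbrakk> \<Longrightarrow> m \<oplus>\<^bsub>M\<^esub> n \<in> N"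
    and act: "\<And>m r. \<lbrakk>m \<in> N; r \<in> carrier R\<rbrakk> \<Longrightarrow> m \<cdot>\<^bsub>M\<^esub> r \<in> N"
  shows "right_submodule N R M"
proof -
  have "\<ominus>\<^bsub>M\<^esub> m \<in> N" if "m \<in> N" for m
    using act[OF that, of "\<ominus>\<^bsub>R\<^esub> \<one>\<^bsub>R\<^esub>"] that assms(1) ract_neg_one
    by (simp add: subset_iff)
  then show ?thesis
    unfolding right_submodule_def
    using assms by (auto intro!: additive_subgroup.intro M.add.subgroupI)
qed

lemma right_submodule_self: "right_submodule (carrier M) R M"
  by (rule right_submoduleI) (auto intro: ract_closed)

lemma right_submodule_module:
  assumes "right_submodule N R M"
  shows "right_module R (M\<lparr>carrier := N\<rparr>)"
proof -
  interpret N: additive_subgroup N M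
    using assms by (simp add: right_submodule_def)
  have sub: "m \<in> carrier M" if "m \<in> N" for m using that by auto
  have ag: "abelian_group (M\<lparr>carrier := N\<rparr>)"
  proof (rule abelian_groupI)
    fix m assume "m \<in> carrier (M\<lparr>carrier := N\<rparr>)"
    then show "\<exists>n\<in>carrier (M\<lparr>carrier := N\<rparr>).
        n \<oplus>\<^bsub>M\<lparr>carrier := N\<rparr>\<^esub> m = \<zero>\<^bsub>M\<lparr>carrier := N\<rparr>\<^esub>"
      by (intro bexI[of _ "\<ominus>\<^bsub>M\<^esub> m"]) (auto simp: M.l_neg sub)
  qed (auto simp: sub M.a_assoc intro: M.a_comm)
  show ?thesis
    using assms
    by (intro right_module.intro right_module_axioms.intro ag R.ring_axioms)
      (auto simp: right_submodule_def sub ract_l_distr ract_r_distr ract_assoc ract_one)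
qed

lemma right_submodule_sub:
  "right_submodule N R M \<Longrightarrow> m \<in> N \<Longrightarrow> m \<in> carrier M"
  by (auto simp: right_submodule_def dest: additive_subgroup.a_subset)

lemma right_submodule_trans:
  assumes "right_submodule N R M" "right_submodule K R (M\<lparr>carrier := N\<rparr>)"
  shows "right_submodule K R M"
proof -
  interpret N: right_module R "M\<lparr>carrier := N\<rparr>"
    by (rule right_submodule_module[OF assms(1)])
  interpret K: additive_subgroup K "M\<lparr>carrier := N\<rparr>"
    using assms(2) by (simp add: right_submodule_def)
  show ?thesis
    using assms(2) K.a_subset K.zero_closed K.a_closed right_submodule_sub[OF assms(1)]
    by (intro right_submoduleI) (auto simp: right_submodule_def)
qed

lemma right_submodule_cyclic:
  assumes m: "m \<in> carrier M"
  shows "right_submodule ((\<lambda>r. m \<cdot>\<^bsub>M\<^esub> r) ` carrier R) R M"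
proof (rule right_submoduleI; clarsimp?)
  show "\<zero>\<^bsub>M\<^esub> \<in> (\<lambda>r. m \<cdot>\<^bsub>M\<^esub> r) ` carrier R"
    using ract_zero[OF m] by (intro image_eqI[of _ _ "\<zero>\<^bsub>R\<^esub>"]) auto
  fix r s assume rs: "r \<in> carrier R" "s \<in> carrier R"
  show "m \<cdot>\<^bsub>M\<^esub> r \<oplus>\<^bsub>M\<^esub> m \<cdot>\<^bsub>M\<^esub> s \<in> (\<lambda>r. m \<cdot>\<^bsub>M\<^esub> r) ` carrier R"
    using ract_r_distr[OF m rs] rs by (intro image_eqI[of _ _ "r \<oplus>\<^bsub>R\<^esub> s"]) auto
  show "m \<cdot>\<^bsub>M\<^esub> r \<cdot>\<^bsub>M\<^esub> s \<in> (\<lambda>r. m \<cdot>\<^bsub>M\<^esub> r) ` carrier R"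
    using ract_assoc[OF m rs] rs by (intro image_eqI[of _ _ "r \<otimes>\<^bsub>R\<^esub> s"]) auto
qed (auto intro: ract_closed m)

lemma cyclic_annihilator_iff:
  assumes m: "m \<in> carrier M"
  shows "r \<in> annihilator R (M\<lparr>carrier := (\<lambda>r. m \<cdot>\<^bsub>M\<^esub> r) ` carrier R\<rparr>) \<longleftrightarrow>
    r \<in> carrier R \<and> (\<forall>s\<in>carrier R. m \<cdot>\<^bsub>M\<^esub> (s \<otimes>\<^bsub>R\<^esub> r) = \<zero>\<^bsub>M\<^esub>)"
  using m by (auto simp: annihilator_def ract_assoc)

text \<open>Annihilators shrink as submodules grow, and every nonzero submodule contains a nonzero
  cyclic one, so primeness is decided on cyclic submodules. The inner condition says that
  \<open>r\<close> annihilates the submodule generated by \<open>m\<close>.\<close>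

lemma prime_module_iff:
  "prime_module R M \<longleftrightarrow> carrier M \<noteq> {\<zero>\<^bsub>M\<^esub>} \<and>
    (\<forall>m\<in>carrier M. \<forall>r\<in>carrier R. m \<noteq> \<zero>\<^bsub>M\<^esub> \<longrightarrow>
       (\<forall>s\<in>carrier R. m \<cdot>\<^bsub>M\<^esub> (s \<otimes>\<^bsub>R\<^esub> r) = \<zero>\<^bsub>M\<^esub>) \<longrightarrow> r \<in> annihilator R M)"
  (is "?l \<longleftrightarrow> ?nz \<and> ?r")
proof (intro iffI conjI ballI impI)
  assume l: ?l
  then show ?nz by (simp add: prime_module_def)
  fix m r assume m: "m \<in> carrier M" "m \<noteq> \<zero>\<^bsub>M\<^esub>" and r: "r \<in> carrier R"
    and z: "\<forall>s\<in>carrier R. m \<cdot>\<^bsub>M\<^esub> (s \<otimes>\<^bsub>R\<^esub> r) = \<zero>\<^bsub>M\<^esub>"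
  let ?N = "(\<lambda>r. m \<cdot>\<^bsub>M\<^esub> r) ` carrier R"
  have "m \<in> ?N"
    using ract_one[OF m(1)] by (intro image_eqI[of _ _ "\<one>\<^bsub>R\<^esub>"]) auto
  then have "?N \<noteq> {\<zero>\<^bsub>M\<^esub>}" using m(2) by auto
  then have "annihilator R (M\<lparr>carrier := ?N\<rparr>) = annihilator R M"
    using l right_submodule_cyclic[OF m(1)] by (auto simp: prime_module_def)
  then show "r \<in> annihilator R M"
    using cyclic_annihilator_iff[OF m(1)] r z by blast
next
  assume "?nz \<and> ?r"
  then have nz: ?nz and r: ?r by auto
  have "annihilator R (M\<lparr>carrier := N\<rparr>) = annihilator R M"
    if N: "right_submodule N R M" "N \<noteq> {\<zero>\<^bsub>M\<^esub>}" for N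
  proof
    interpret N: additive_subgroup N M
      using N by (simp add: right_submodule_def)
    obtain m where m: "m \<in> N" "m \<noteq> \<zero>\<^bsub>M\<^esub>"
      using N(2) N.zero_closed by auto
    show "annihilator R (M\<lparr>carrier := N\<rparr>) \<subseteq> annihilator R M"
    proof
      fix x assume x: "x \<in> annihilator R (M\<lparr>carrier := N\<rparr>)"
      then have xR: "x \<in> carrier R" by (simp add: annihilator_def)
      have "m \<cdot>\<^bsub>M\<^esub> (s \<otimes>\<^bsub>R\<^esub> x) = \<zero>\<^bsub>M\<^esub>" if s: "s \<in> carrier R" for s
        using x N(1) m(1) s xR by (simp add: annihilator_def right_submodule_def ract_assoc)
      then show "x \<in> annihilator R M"
        using r m xR by auto
    qed
    show "annihilator R M \<subseteq> annihilator R (M\<lparr>carrier := N\<rparr>)"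
      by (auto simp: annihilator_def)
  qed
  then show ?l using nz by (simp add: prime_module_def)
qed

lemma prime_submodule:
  assumes "prime_module R M" "right_submodule N R M" "N \<noteq> {\<zero>\<^bsub>M\<^esub>}"
  shows "prime_module R (M\<lparr>carrier := N\<rparr>)"
proof -
  have "annihilator R (M\<lparr>carrier := K\<rparr>) = annihilator R (M\<lparr>carrier := N\<rparr>)"
    if "right_submodule K R (M\<lparr>carrier := N\<rparr>)" "K \<noteq> {\<zero>\<^bsub>M\<^esub>}" for K
    using assms that right_submodule_trans[OF assms(2) that(1)]
    by (simp add: prime_module_def)
  then show ?thesis using assms(3) by (simp add: prime_module_def)
qed

text \<open>Brings annihilators within reach of the chain condition.\<close>

lemma annihilator_ideal: "ideal (annihilator R M) R"
proof (rule idealI)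
  show "subgroup (annihilator R M) (add_monoid R)"
  proof (rule R.add.subgroupI)
    show "annihilator R M \<noteq> {}"
      using ract_zero by (auto simp: annihilator_def)
    fix a assume a: "a \<in> annihilator R M"
    have "m \<cdot>\<^bsub>M\<^esub> (\<ominus>\<^bsub>R\<^esub> a) = \<zero>\<^bsub>M\<^esub>" if "m \<in> carrier M" for m
    proof -
      have "m \<cdot>\<^bsub>M\<^esub> (\<ominus>\<^bsub>R\<^esub> a) \<oplus>\<^bsub>M\<^esub> m \<cdot>\<^bsub>M\<^esub> a = \<zero>\<^bsub>M\<^esub>"
        using a that ract_r_distr[of m "\<ominus>\<^bsub>R\<^esub> a" a]
        by (simp add: annihilator_def R.l_neg ract_zero)
      then show ?thesis
        using a that ract_closed[of m "\<ominus>\<^bsub>R\<^esub> a"] by (simp add: annihilator_def)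
    qed
    then show "\<ominus>\<^bsub>R\<^esub> a \<in> annihilator R M"
      using a by (simp add: annihilator_def)
  qed (auto simp: annihilator_def ract_r_distr)
qed (auto simp: annihilator_def ract_assoc ract_closed zero_ract R.ring_axioms)

lemma ract_finsum:
  assumes "m \<in> carrier M" "\<And>i. f i \<in> carrier R"
  shows "m \<cdot>\<^bsub>M\<^esub> (\<Oplus>\<^bsub>R\<^esub>i\<in>{..n::nat}. f i) = (\<Oplus>\<^bsub>M\<^esub>i\<in>{..n}. m \<cdot>\<^bsub>M\<^esub> f i)"
proof (induction n)
  case (Suc n)
  then show ?case
    using assms by (simp add: R.finsum_Suc M.finsum_Suc ract_closed ract_r_distr Pi_def)
qed (use assms in \<open>simp add: ract_closed Pi_def\<close>)

lemma finsum_ract: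
  assumes "r \<in> carrier R" "\<And>i. f i \<in> carrier M"
  shows "(\<Oplus>\<^bsub>M\<^esub>i\<in>{..n::nat}. f i) \<cdot>\<^bsub>M\<^esub> r = (\<Oplus>\<^bsub>M\<^esub>i\<in>{..n}. f i \<cdot>\<^bsub>M\<^esub> r)"
proof (induction n)
  case (Suc n)
  then show ?case
    using assms by (simp add: M.finsum_Suc ract_closed ract_l_distr Pi_def)
qed (use assms in \<open>simp add: ract_closed Pi_def\<close>)

end

text \<open>An embedding over a change of scalars \<open>\<theta>\<close>. With
  \<open>\<theta>\<close> equal to \<open>id\<close> it covers inclusions and shifts; a proper
  change of scalars appears for twists, where \<open>\<theta>\<close> applies a power of \<sigma> to
  each coefficient.\<close>

definition semilinear_embedding ::
    "('a, 'c) ring_scheme \<Rightarrow> ('a, 'b, 'm) right_module_scheme \<Rightarrow>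
     ('d, 'e) ring_scheme \<Rightarrow> ('d, 'f, 'n) right_module_scheme \<Rightarrow> ('a \<Rightarrow> 'd) \<Rightarrow> ('b \<Rightarrow> 'f) \<Rightarrow> bool"
  where "semilinear_embedding R A R' B \<theta> \<phi> \<longleftrightarrow>
    right_module R A \<and> right_module R' B \<and> \<theta> ` carrier R = carrier R' \<and>
    \<phi> ` carrier A \<subseteq> carrier B \<and> inj_on \<phi> (carrier A) \<and> \<phi> \<zero>\<^bsub>A\<^esub> = \<zero>\<^bsub>B\<^esub> \<and>
    (\<forall>m\<in>carrier A. \<forall>n\<in>carrier A. \<phi> (m \<oplus>\<^bsub>A\<^esub> n) = \<phi> m \<oplus>\<^bsub>B\<^esub> \<phi> n) \<and>
    (\<forall>m\<in>carrier A. \<forall>r\<in>carrier R. \<phi> (m \<cdot>\<^bsub>A\<^esub> r) = \<phi> m \<cdot>\<^bsub>B\<^esub> \<theta> r)"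

text \<open>Since \<open>\<theta>\<close> is onto, the cyclic submodule of \<open>m\<close> is
  carried onto that of \<open>\<phi> m\<close>, and by injectivity the same products vanish on both
  sides. Hence the criterion \<open>prime_module_iff\<close> transfers in both directions.\<close>

lemma semilinear_embedding_image:
  assumes "semilinear_embedding R A R' B \<theta> \<phi>"
  shows semilinear_embedding_submodule: "right_submodule (\<phi> ` carrier A) R' B"
    and semilinear_embedding_annihilator:
      "annihilator R A = {r \<in> carrier R. \<theta> r \<in> annihilator R' (B\<lparr>carrier := \<phi> ` carrier A\<rparr>)}"
    and semilinear_embedding_prime:
      "prime_module R A \<longleftrightarrow> prime_module R' (B\<lparr>carrier := \<phi> ` carrier A\<rparr>)"
proof -
  interpret A: right_module R A using assms by (simp add: semilinear_embedding_def)
  interpret B: right_module R' B using assms by (simp add: semilinear_embedding_def)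
  have onto: "\<theta> ` carrier R = carrier R'" and sub: "\<phi> ` carrier A \<subseteq> carrier B"
    and inj: "inj_on \<phi> (carrier A)" and z: "\<phi> \<zero>\<^bsub>A\<^esub> = \<zero>\<^bsub>B\<^esub>"
    and add: "\<And>m n. \<lbrakk>m \<in> carrier A; n \<in> carrier A\<rbrakk> \<Longrightarrow> \<phi> m \<oplus>\<^bsub>B\<^esub> \<phi> n = \<phi> (m \<oplus>\<^bsub>A\<^esub> n)"
    and act: "\<And>m r. \<lbrakk>m \<in> carrier A; r \<in> carrier R\<rbrakk> \<Longrightarrow> \<phi> m \<cdot>\<^bsub>B\<^esub> \<theta> r = \<phi> (m \<cdot>\<^bsub>A\<^esub> r)"
    using assms by (auto simp: semilinear_embedding_def)
  have phi: "\<phi> m \<in> carrier B" if "m \<in> carrier A" for m using sub that by auto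
  have theta: "\<theta> r \<in> carrier R'" if "r \<in> carrier R" for r using onto that by auto
  have zero_iff: "\<phi> m = \<zero>\<^bsub>B\<^esub> \<longleftrightarrow> m = \<zero>\<^bsub>A\<^esub>" if "m \<in> carrier A" for m
    using inj that z inj_on_eq_iff[OF inj, of m "\<zero>\<^bsub>A\<^esub>"] by auto
  show subm: "right_submodule (\<phi> ` carrier A) R' B"
  proof (rule B.right_submoduleI[OF sub])
    show "\<zero>\<^bsub>B\<^esub> \<in> \<phi> ` carrier A" using z by (metis A.M.zero_closed imageI)
    show "m \<oplus>\<^bsub>B\<^esub> n \<in> \<phi> ` carrier A" if "m \<in> \<phi> ` carrier A" "n \<in> \<phi> ` carrier A" for m n
      using that by (auto simp: add)
    show "m \<cdot>\<^bsub>B\<^esub> r \<in> \<phi> ` carrier A" if "m \<in> \<phi> ` carrier A" "r \<in> carrier R'" for m r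
      using that by (auto simp: act A.ract_closed simp flip: onto)
  qed
  interpret N: right_module R' "B\<lparr>carrier := \<phi> ` carrier A\<rparr>"
    by (rule B.right_submodule_module[OF subm])
  show ann: "annihilator R A = {r \<in> carrier R. \<theta> r \<in> annihilator R' (B\<lparr>carrier := \<phi> ` carrier A\<rparr>)}"
    by (auto simp: annihilator_def act zero_iff theta A.ract_closed)
  \<comment> \<open>The action of a product is split into two successive actions, and each scalar is
    then moved through \<open>\<phi>\<close> by itself.\<close>
  have cyc: "(\<forall>s\<in>carrier R'. \<phi> m \<cdot>\<^bsub>B\<^esub> (s \<otimes>\<^bsub>R'\<^esub> \<theta> r) = \<zero>\<^bsub>B\<^esub>) \<longleftrightarrow>
      (\<forall>s\<in>carrier R. m \<cdot>\<^bsub>A\<^esub> (s \<otimes>\<^bsub>R\<^esub> r) = \<zero>\<^bsub>A\<^esub>)"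
    if "m \<in> carrier A" "r \<in> carrier R" for m r
    using that
    by (auto simp: B.ract_assoc A.ract_assoc phi theta act zero_iff A.ract_closed simp flip: onto)
  have cyc': "(\<forall>s\<in>carrier R. \<phi> m \<cdot>\<^bsub>B\<^esub> (\<theta> s \<otimes>\<^bsub>R'\<^esub> \<theta> r) = \<zero>\<^bsub>B\<^esub>) \<longleftrightarrow>
      (\<forall>s\<in>carrier R. m \<cdot>\<^bsub>A\<^esub> (s \<otimes>\<^bsub>R\<^esub> r) = \<zero>\<^bsub>A\<^esub>)"
    if "m \<in> carrier A" "r \<in> carrier R" for m r
    using cyc[OF that] by (simp flip: onto)
  have nz: "\<phi> ` carrier A = {\<zero>\<^bsub>B\<^esub>} \<longleftrightarrow> carrier A = {\<zero>\<^bsub>A\<^esub>}"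
    using zero_iff z by auto
  show "prime_module R A \<longleftrightarrow> prime_module R' (B\<lparr>carrier := \<phi> ` carrier A\<rparr>)"
    unfolding A.prime_module_iff N.prime_module_iff
    by (simp add: nz cyc' zero_iff ann flip: onto)
qed

lemma semilinear_embedding_comp:
  assumes "semilinear_embedding R A R' B \<theta> \<phi>" "semilinear_embedding R' B R'' C \<theta>' \<phi>'"
  shows "semilinear_embedding R A R'' C (\<theta>' \<circ> \<theta>) (\<phi>' \<circ> \<phi>)"
proof -
  have "inj_on (\<phi>' \<circ> \<phi>) (carrier A)"
    using assms by (auto simp: semilinear_embedding_def intro: comp_inj_on inj_on_subset)
  moreover have "\<theta> r \<in> carrier R'" if "r \<in> carrier R" for r
    using assms that by (auto simp: semilinear_embedding_def)
  moreover have "(\<lambda>x. \<theta>' (\<theta> x)) ` carrier R = carrier R''"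
    using assms by (simp add: semilinear_embedding_def flip: image_image)
  ultimately show ?thesis
    using assms by (simp add: semilinear_embedding_def image_subset_iff)
qed

text \<open>Equal annihilators of the elements \<open>a\<close> and \<open>b\<close> make
  \<open>A\<close> isomorphic to the nonzero submodule generated by \<open>b\<close> in the prime
  module \<open>B\<close>. Comparing which products vanish replaces the construction of the
  isomorphism.\<close>

lemma cyclic_prime_transfer:
  assumes A: "right_module R A" and B: "right_module R B"
    and P: "prime_module R B"
    and a: "a \<in> carrier A" "carrier A = (\<lambda>r. a \<cdot>\<^bsub>A\<^esub> r) ` carrier R"
    and b: "b \<in> carrier B" "b \<noteq> \<zero>\<^bsub>B\<^esub>"
    and iff: "\<And>r. r \<in> carrier R \<Longrightarrow> a \<cdot>\<^bsub>A\<^esub> r = \<zero>\<^bsub>A\<^esub> \<longleftrightarrow> b \<cdot>\<^bsub>B\<^esub> r = \<zero>\<^bsub>B\<^esub>"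
  shows "prime_module R A" "annihilator R A = annihilator R B"
proof -
  interpret A: right_module R A by fact
  interpret B: right_module R B by fact
  have iff2: "a \<cdot>\<^bsub>A\<^esub> r \<cdot>\<^bsub>A\<^esub> s = \<zero>\<^bsub>A\<^esub> \<longleftrightarrow> b \<cdot>\<^bsub>B\<^esub> r \<cdot>\<^bsub>B\<^esub> s = \<zero>\<^bsub>B\<^esub>"
    if "r \<in> carrier R" "s \<in> carrier R" for r s
    using iff[of "r \<otimes>\<^bsub>R\<^esub> s"] that a(1) b(1) by (simp add: A.ract_assoc B.ract_assoc)
  \<comment> \<open>By primeness the annihilator of \<open>B\<close> can be read off from the cyclic
    submodule of \<open>b\<close>.\<close>
  have annB: "annihilator R B =
      {r \<in> carrier R. \<forall>s\<in>carrier R. b \<cdot>\<^bsub>B\<^esub> s \<cdot>\<^bsub>B\<^esub> r = \<zero>\<^bsub>B\<^esub>}" (is "_ = ?X")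
  proof
    show "annihilator R B \<subseteq> ?X" using b(1) by (auto simp: annihilator_def B.ract_closed)
    show "?X \<subseteq> annihilator R B"
      using P b unfolding B.prime_module_iff by (auto simp: B.ract_assoc)
  qed
  have annA: "annihilator R A =
      {r \<in> carrier R. \<forall>s\<in>carrier R. a \<cdot>\<^bsub>A\<^esub> s \<cdot>\<^bsub>A\<^esub> r = \<zero>\<^bsub>A\<^esub>}"
    unfolding annihilator_def by (subst a(2)) auto
  show eq: "annihilator R A = annihilator R B"
    unfolding annA annB by (auto simp: iff2)
  have "a \<noteq> \<zero>\<^bsub>A\<^esub>"
    using iff[of "\<one>\<^bsub>R\<^esub>"] a(1) b by (simp add: A.ract_one B.ract_one)
  then have nz: "carrier A \<noteq> {\<zero>\<^bsub>A\<^esub>}" using a(1) by auto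
  show "prime_module R A"
    unfolding A.prime_module_iff
  proof (intro conjI nz ballI impI)
    fix m r assume m: "m \<in> carrier A" "m \<noteq> \<zero>\<^bsub>A\<^esub>" and r: "r \<in> carrier R"
      and z: "\<forall>s\<in>carrier R. m \<cdot>\<^bsub>A\<^esub> (s \<otimes>\<^bsub>R\<^esub> r) = \<zero>\<^bsub>A\<^esub>"
    obtain t where t: "t \<in> carrier R" "m = a \<cdot>\<^bsub>A\<^esub> t" using m(1) a(2) by auto
    have "b \<cdot>\<^bsub>B\<^esub> t \<noteq> \<zero>\<^bsub>B\<^esub>" using iff m(2) t by auto
    moreover have "\<forall>s\<in>carrier R. b \<cdot>\<^bsub>B\<^esub> t \<cdot>\<^bsub>B\<^esub> (s \<otimes>\<^bsub>R\<^esub> r) = \<zero>\<^bsub>B\<^esub>"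
      using z t r by (auto simp: iff2)
    ultimately show "r \<in> annihilator R A"
      unfolding eq using P b(1) t(1) r unfolding B.prime_module_iff
      by (auto simp: B.ract_closed)
  qed
qed

section \<open>The module \<open>M[x;\<sigma>]\<close> over \<open>R[x;\<sigma>]\<close>\<close>

text \<open>The triangle of pairs with \<open>j + l \<le> n\<close> is summed by diagonals and by
  rows; associativity of the convolution comes down to this.\<close>

lemma (in abelian_monoid) finsum_triangle:
  assumes "\<And>i j. F i j \<in> carrier G"
  shows "(\<Oplus>i\<in>{..n::nat}. \<Oplus>j\<in>{..i}. F j (i - j)) = (\<Oplus>j\<in>{..n}. \<Oplus>l\<in>{..n - j}. F j l)"
proof (induction n)
  case (Suc n)
  have "(\<Oplus>j\<in>{..n}. \<Oplus>l\<in>{..Suc n - j}. F j l)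
      = (\<Oplus>j\<in>{..n}. F j (Suc n - j) \<oplus> (\<Oplus>l\<in>{..n - j}. F j l))"
    using assms by (intro finsum_cong) (auto simp: Suc_diff_le finsum_Suc simp_implies_def)
  also have "\<dots> = (\<Oplus>j\<in>{..n}. F j (Suc n - j)) \<oplus> (\<Oplus>j\<in>{..n}. \<Oplus>l\<in>{..n - j}. F j l)"
    using assms by (intro finsum_addf) auto
  finally show ?case
    using assms Suc by (simp add: finsum_Suc Pi_def a_ac)
qed (use assms in \<open>simp add: Pi_def\<close>)

lemma (in abelian_monoid) finsum_single:
  assumes "f j \<in> carrier G" "j \<le> n" "\<And>i. i \<le> n \<Longrightarrow> i \<noteq> j \<Longrightarrow> f i = \<zero>"
  shows "(\<Oplus>i\<in>{..n::nat}. f i) = f j"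
proof -
  have "(\<Oplus>i\<in>{..n}. f i) = (\<Oplus>i\<in>{..n}. if j = i then f i else \<zero>)"
    using assms by (intro finsum_cong') auto
  also have "\<dots> = f j"
    using assms by (intro finsum_singleton) (auto simp: Pi_def, metis zero_closed)
  finally show ?thesis .
qed

lemma up_iff: "f \<in> up R \<longleftrightarrow> (\<forall>n. f n \<in> carrier R) \<and> (\<exists>N. \<forall>n>N. f n = \<zero>\<^bsub>R\<^esub>)"
  by (auto simp: up_def Pi_def bound_def)

lemma up_boundE:
  assumes "f \<in> up R" obtains N where "\<And>n. n > N \<Longrightarrow> f n = \<zero>\<^bsub>R\<^esub>"
  using assms by (auto simp: up_iff)

lemma ring_hom_funpow:
  assumes "\<sigma> \<in> ring_hom R R" shows "\<sigma> ^^ n \<in> ring_hom R R"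
proof (induction n)
  case (Suc n)
  then show ?case
    using assms ring_hom_trans[of "\<sigma> ^^ n" R R \<sigma> R] by (simp only: funpow.simps)
qed (auto simp: ring_hom_def)

lemma skew_poly_ring_simps:
  "carrier (skew_poly_ring R \<sigma>) = up R"
  "\<zero>\<^bsub>skew_poly_ring R \<sigma>\<^esub> = (\<lambda>n. \<zero>\<^bsub>R\<^esub>)"
  "\<one>\<^bsub>skew_poly_ring R \<sigma>\<^esub> = (\<lambda>n. if n = 0 then \<one>\<^bsub>R\<^esub> else \<zero>\<^bsub>R\<^esub>)"
  "f \<oplus>\<^bsub>skew_poly_ring R \<sigma>\<^esub> g = (\<lambda>n. f n \<oplus>\<^bsub>R\<^esub> g n)"
  "f \<otimes>\<^bsub>skew_poly_ring R \<sigma>\<^esub> g = (\<lambda>n. \<Oplus>\<^bsub>R\<^esub>i\<in>{..n}. f i \<otimes>\<^bsub>R\<^esub> (\<sigma> ^^ i) (g (n - i)))"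
  by (simp_all add: skew_poly_ring_def)

lemma skew_poly_module_simps:
  "carrier (skew_poly_module M \<sigma>) = up M"
  "\<zero>\<^bsub>skew_poly_module M \<sigma>\<^esub> = (\<lambda>n. \<zero>\<^bsub>M\<^esub>)"
  "f \<oplus>\<^bsub>skew_poly_module M \<sigma>\<^esub> f' = (\<lambda>n. f n \<oplus>\<^bsub>M\<^esub> f' n)"
  "f \<cdot>\<^bsub>skew_poly_module M \<sigma>\<^esub> g = (\<lambda>n. \<Oplus>\<^bsub>M\<^esub>i\<in>{..n}. f i \<cdot>\<^bsub>M\<^esub> (\<sigma> ^^ i) (g (n - i)))"
  by (simp_all add: skew_poly_module_def)

text \<open>Stated for any record with pointwise zero and addition, so that it serves both
  \<open>S\<close> and \<open>Mx\<close>.\<close>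

lemma abelian_group_up:
  assumes "abelian_group G" "carrier H = up G" "\<zero>\<^bsub>H\<^esub> = (\<lambda>n. \<zero>\<^bsub>G\<^esub>)"
    and add: "\<And>f g. f \<oplus>\<^bsub>H\<^esub> g = (\<lambda>n. f n \<oplus>\<^bsub>G\<^esub> g n)"
  shows "abelian_group H"
proof -
  interpret G: abelian_group G by fact
  show ?thesis
  proof (rule abelian_groupI)
    fix f g assume fg: "f \<in> carrier H" "g \<in> carrier H"
    obtain a where a: "\<And>n. n > a \<Longrightarrow> f n = \<zero>\<^bsub>G\<^esub>"
      using up_boundE[of f G] fg unfolding assms(2) by blast
    obtain b where b: "\<And>n. n > b \<Longrightarrow> g n = \<zero>\<^bsub>G\<^esub>"
      using up_boundE[of g G] fg unfolding assms(2) by blast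
    show "f \<oplus>\<^bsub>H\<^esub> g \<in> carrier H"
      using fg a b unfolding assms(2) add up_iff by (auto intro!: exI[of _ "max a b"])
    have "(\<lambda>n. \<ominus>\<^bsub>G\<^esub> f n) \<in> carrier H"
      using fg a unfolding assms(2) up_iff by (auto intro!: exI[of _ a])
    moreover have "(\<lambda>n. \<ominus>\<^bsub>G\<^esub> f n) \<oplus>\<^bsub>H\<^esub> f = \<zero>\<^bsub>H\<^esub>"
      using fg unfolding assms(2,3) add up_iff by (auto simp: G.l_neg)
    ultimately show "\<exists>y\<in>carrier H. y \<oplus>\<^bsub>H\<^esub> f = \<zero>\<^bsub>H\<^esub>" by blast
  qed (auto simp: assms(2,3) add up_iff G.a_ac)
qed

text \<open>\<open>R\<close> as a right module over itself; \<open>S\<close> is then \<open>R[x;\<sigma>]\<close> as an \<open>S\<close>-module, so that the ring axioms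
  of \<open>S\<close> are instances of the module axioms.\<close>

definition regular_module :: "('a, 'c) ring_scheme \<Rightarrow> ('a, 'a) right_module" where
  "regular_module R = \<lparr>carrier = carrier R, mult = mult R, one = \<one>\<^bsub>R\<^esub>, zero = \<zero>\<^bsub>R\<^esub>, add = add R,
     ract = mult R\<rparr>"

section \<open>The convolution action on coefficient sequences\<close>

locale skew_module = right_module +
  fixes \<sigma> :: "'a \<Rightarrow> 'a"
  assumes sigma_hom: "\<sigma> \<in> ring_hom R R"
begin

abbreviation S where "S \<equiv> skew_poly_ring R \<sigma>"
abbreviation Mx where "Mx \<equiv> skew_poly_module M \<sigma>"

lemmas sigma_pow_hom = ring_hom_funpow[OF sigma_hom]

lemma sigma_pow_closed [simp]: "r \<in> carrier R \<Longrightarrow> (\<sigma> ^^ n) r \<in> carrier R"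
  using ring_hom_closed[OF sigma_pow_hom] .

lemma sigma_pow_simps:
  "\<lbrakk>r \<in> carrier R; s \<in> carrier R\<rbrakk> \<Longrightarrow> (\<sigma> ^^ n) (r \<oplus>\<^bsub>R\<^esub> s) = (\<sigma> ^^ n) r \<oplus>\<^bsub>R\<^esub> (\<sigma> ^^ n) s"
  "\<lbrakk>r \<in> carrier R; s \<in> carrier R\<rbrakk> \<Longrightarrow> (\<sigma> ^^ n) (r \<otimes>\<^bsub>R\<^esub> s) = (\<sigma> ^^ n) r \<otimes>\<^bsub>R\<^esub> (\<sigma> ^^ n) s"
  "(\<sigma> ^^ n) \<zero>\<^bsub>R\<^esub> = \<zero>\<^bsub>R\<^esub>"
  "(\<sigma> ^^ n) \<one>\<^bsub>R\<^esub> = \<one>\<^bsub>R\<^esub>"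
  using sigma_pow_hom[of n] R.ring_axioms
  by (auto simp: ring_hom_add ring_hom_mult ring_hom_one intro: ring_hom_zero)

lemma sigma_pow_finsum:
  assumes "\<And>i. f i \<in> carrier R"
  shows "(\<sigma> ^^ k) (\<Oplus>\<^bsub>R\<^esub>i\<in>{..n::nat}. f i) = (\<Oplus>\<^bsub>R\<^esub>i\<in>{..n}. (\<sigma> ^^ k) (f i))"
  using assms by (induction n) (simp_all add: sigma_pow_simps Pi_def)

lemma upR_closed [simp]: "g \<in> up R \<Longrightarrow> g n \<in> carrier R" by (simp add: up_iff)
lemma upM_closed [simp]: "f \<in> up M \<Longrightarrow> f n \<in> carrier M" by (simp add: up_iff)

lemma skew_ract_closed:
  assumes "f \<in> up M" "g \<in> up R"
  shows "f \<cdot>\<^bsub>Mx\<^esub> g \<in> up M"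
proof -
  obtain a where a: "\<And>n. n > a \<Longrightarrow> f n = \<zero>\<^bsub>M\<^esub>"
    using up_boundE[OF assms(1)] by blast
  obtain b where b: "\<And>n. n > b \<Longrightarrow> g n = \<zero>\<^bsub>R\<^esub>"
    using up_boundE[OF assms(2)] by blast
  \<comment> \<open>When \<open>n > a + b\<close>, every index has \<open>i > a\<close> or
    \<open>n - i > b\<close>, so one factor of each summand is zero.\<close>
  have "(f \<cdot>\<^bsub>Mx\<^esub> g) n = \<zero>\<^bsub>M\<^esub>" if n: "n > a + b" for n
    unfolding skew_poly_module_simps
  proof (intro M.add.finprod_one_eqI)
    fix i assume "i \<in> {..n}"
    then show "f i \<cdot>\<^bsub>M\<^esub> (\<sigma> ^^ i) (g (n - i)) = \<zero>\<^bsub>M\<^esub>"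
      using a[of i] b[of "n - i"] n assms
      by (cases "i > a") (auto simp: zero_ract ract_zero sigma_pow_simps)
  qed
  then show ?thesis
    unfolding up_iff using assms by (auto simp: skew_poly_module_simps ract_closed)
qed

lemma skew_ract_assoc:
  assumes f: "f \<in> up M" and g: "g \<in> up R" and h: "h \<in> up R"
  shows "f \<cdot>\<^bsub>Mx\<^esub> (g \<otimes>\<^bsub>S\<^esub> h) = f \<cdot>\<^bsub>Mx\<^esub> g \<cdot>\<^bsub>Mx\<^esub> h"
proof
  fix n
  \<comment> \<open>The contribution of the terms of degree \<open>j\<close> in \<open>f\<close>,
    \<open>l\<close> in \<open>g\<close> and \<open>n - (j + l)\<close> in \<open>h\<close>. One
    side groups these by \<open>j\<close>, the other by \<open>j + l\<close>.\<close>
  define F where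
    "F j l = f j \<cdot>\<^bsub>M\<^esub> ((\<sigma> ^^ j) (g l) \<otimes>\<^bsub>R\<^esub> (\<sigma> ^^ (j + l)) (h (n - (j + l))))" for j l
  have F: "F j l \<in> carrier M" for j l using f g h by (simp add: F_def ract_closed)
  have "(f \<cdot>\<^bsub>Mx\<^esub> (g \<otimes>\<^bsub>S\<^esub> h)) n = (\<Oplus>\<^bsub>M\<^esub>j\<in>{..n}. \<Oplus>\<^bsub>M\<^esub>l\<in>{..n - j}. F j l)"
    unfolding skew_poly_module_simps skew_poly_ring_simps
  proof (intro M.finsum_cong' refl)
    fix j
    have "f j \<cdot>\<^bsub>M\<^esub> (\<sigma> ^^ j) (\<Oplus>\<^bsub>R\<^esub>l\<in>{..n - j}. g l \<otimes>\<^bsub>R\<^esub> (\<sigma> ^^ l) (h (n - j - l)))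
        = (\<Oplus>\<^bsub>M\<^esub>l\<in>{..n - j}. f j \<cdot>\<^bsub>M\<^esub> (\<sigma> ^^ j) (g l \<otimes>\<^bsub>R\<^esub> (\<sigma> ^^ l) (h (n - j - l))))"
      using f g h by (simp add: sigma_pow_finsum ract_finsum)
    also have "\<dots> = (\<Oplus>\<^bsub>M\<^esub>l\<in>{..n - j}. F j l)"
      using f g h F
      by (intro M.finsum_cong') (auto simp: F_def sigma_pow_simps funpow_add)
    finally show "f j \<cdot>\<^bsub>M\<^esub> (\<sigma> ^^ j) (\<Oplus>\<^bsub>R\<^esub>l\<in>{..n - j}. g l \<otimes>\<^bsub>R\<^esub> (\<sigma> ^^ l) (h (n - j - l)))
        = (\<Oplus>\<^bsub>M\<^esub>l\<in>{..n - j}. F j l)" .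
  qed (use F in auto)
  also have "\<dots> = (\<Oplus>\<^bsub>M\<^esub>i\<in>{..n}. \<Oplus>\<^bsub>M\<^esub>j\<in>{..i}. F j (i - j))"
    using M.finsum_triangle[of F n] F by simp
  also have "\<dots> = (f \<cdot>\<^bsub>Mx\<^esub> g \<cdot>\<^bsub>Mx\<^esub> h) n"
    unfolding skew_poly_module_simps
  proof (intro M.finsum_cong' refl)
    fix i
    have "(\<Oplus>\<^bsub>M\<^esub>j\<in>{..i}. f j \<cdot>\<^bsub>M\<^esub> (\<sigma> ^^ j) (g (i - j))) \<cdot>\<^bsub>M\<^esub> (\<sigma> ^^ i) (h (n - i))
        = (\<Oplus>\<^bsub>M\<^esub>j\<in>{..i}. f j \<cdot>\<^bsub>M\<^esub> (\<sigma> ^^ j) (g (i - j)) \<cdot>\<^bsub>M\<^esub> (\<sigma> ^^ i) (h (n - i)))"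
      using f g h by (simp add: finsum_ract ract_closed)
    also have "\<dots> = (\<Oplus>\<^bsub>M\<^esub>j\<in>{..i}. F j (i - j))"
      using f g h F by (intro M.finsum_cong') (auto simp: F_def ract_assoc ract_closed)
    finally show "(\<Oplus>\<^bsub>M\<^esub>j\<in>{..i}. F j (i - j)) =
        (\<Oplus>\<^bsub>M\<^esub>j\<in>{..i}. f j \<cdot>\<^bsub>M\<^esub> (\<sigma> ^^ j) (g (i - j))) \<cdot>\<^bsub>M\<^esub> (\<sigma> ^^ i) (h (n - i))" ..
  qed (use f g h in \<open>auto intro!: ract_closed M.finsum_closed\<close>)
  finally show "(f \<cdot>\<^bsub>Mx\<^esub> (g \<otimes>\<^bsub>S\<^esub> h)) n = (f \<cdot>\<^bsub>Mx\<^esub> g \<cdot>\<^bsub>Mx\<^esub> h) n" .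
qed

text \<open>A scalar acts on each coefficient separately, because x^n r is \<sigma>^n(r) x^n. It can
  therefore erase terms but never create them, which is what the minimal support argument
  exploits.\<close>

lemma skew_ract_const:
  assumes "f \<in> up M" "r \<in> carrier R"
  shows "f \<cdot>\<^bsub>Mx\<^esub> (\<lambda>n. if n = 0 then r else \<zero>\<^bsub>R\<^esub>) = (\<lambda>n. f n \<cdot>\<^bsub>M\<^esub> (\<sigma> ^^ n) r)"
proof
  fix n
  have "(f \<cdot>\<^bsub>Mx\<^esub> (\<lambda>n. if n = 0 then r else \<zero>\<^bsub>R\<^esub>)) n =
      f n \<cdot>\<^bsub>M\<^esub> (\<sigma> ^^ n) (if n - n = 0 then r else \<zero>\<^bsub>R\<^esub>)"
    unfolding skew_poly_module_simps using assms
    by (intro M.finsum_single) (auto simp: ract_closed sigma_pow_simps ract_zero)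
  then show "(f \<cdot>\<^bsub>Mx\<^esub> (\<lambda>n. if n = 0 then r else \<zero>\<^bsub>R\<^esub>)) n = f n \<cdot>\<^bsub>M\<^esub> (\<sigma> ^^ n) r" by simp
qed

lemma monomial_up: "m \<in> carrier M \<Longrightarrow> (\<lambda>i. if i = n then m else \<zero>\<^bsub>M\<^esub>) \<in> up M"
  by (auto simp: up_iff intro!: exI[of _ n])

lemma monomial_ract:
  assumes "m \<in> carrier M" "g \<in> up R"
  shows "(\<lambda>i. if i = n then m else \<zero>\<^bsub>M\<^esub>) \<cdot>\<^bsub>Mx\<^esub> g =
    (\<lambda>i. if i < n then \<zero>\<^bsub>M\<^esub> else m \<cdot>\<^bsub>M\<^esub> (\<sigma> ^^ n) (g (i - n)))" (is "?l = ?r")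
proof
  fix i
  show "?l i = ?r i"
  proof (cases "i < n")
    case True
    then show ?thesis
      unfolding skew_poly_module_simps using assms
      by (auto intro!: M.add.finprod_one_eqI simp: zero_ract)
  next
    case False
    have "?l i = (if n = n then m else \<zero>\<^bsub>M\<^esub>) \<cdot>\<^bsub>M\<^esub> (\<sigma> ^^ n) (g (i - n))"
      unfolding skew_poly_module_simps using assms False
      by (intro M.finsum_single) (auto simp: ract_closed zero_ract)
    then show ?thesis using False by simp
  qed
qed

lemma skew_ract_l_distr:
  assumes "f \<in> up M" "g \<in> up M" "h \<in> up R"
  shows "(f \<oplus>\<^bsub>Mx\<^esub> g) \<cdot>\<^bsub>Mx\<^esub> h = f \<cdot>\<^bsub>Mx\<^esub> h \<oplus>\<^bsub>Mx\<^esub> g \<cdot>\<^bsub>Mx\<^esub> h"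
  unfolding skew_poly_module_simps using assms
  by (intro ext) (simp add: ract_l_distr ract_closed M.finsum_addf Pi_def)

lemma skew_ract_r_distr:
  assumes "f \<in> up M" "g \<in> up R" "h \<in> up R"
  shows "f \<cdot>\<^bsub>Mx\<^esub> (g \<oplus>\<^bsub>S\<^esub> h) = f \<cdot>\<^bsub>Mx\<^esub> g \<oplus>\<^bsub>Mx\<^esub> f \<cdot>\<^bsub>Mx\<^esub> h"
  unfolding skew_poly_module_simps skew_poly_ring_simps using assms
  by (intro ext) (simp add: ract_r_distr ract_closed sigma_pow_simps M.finsum_addf Pi_def)

end

lemma (in ring) skew_module_regular:
  assumes "\<sigma> \<in> ring_hom R R"
  shows "skew_module R (regular_module R) \<sigma>"
proof -
  have "abelian_group (regular_module R)"
    by (rule abelian_groupI)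
      (auto simp: regular_module_def a_assoc intro: a_comm bexI[of _ "\<ominus> x" for x] l_neg)
  then show ?thesis
    by (intro skew_module.intro right_module.intro right_module_axioms.intro
        skew_module_axioms.intro assms ring_axioms)
      (auto simp: regular_module_def l_distr r_distr m_assoc)
qed

context skew_module
begin

lemma ring_S: "ring S"
proof -
  interpret reg: skew_module R "regular_module R" \<sigma>
    by (rule R.skew_module_regular[OF sigma_hom])
  \<comment> \<open>\<open>finsum\<close> depends only on the additive structure, which
    \<open>regular_module R\<close> shares with \<open>R\<close>.\<close>
  have fs: "finsum (regular_module R) = finsum R"
    by (intro ext) (simp add: finsum_def finprod_def regular_module_def)
  have zero: "\<zero>\<^bsub>regular_module R\<^esub> = \<zero>\<^bsub>R\<^esub>"
    by (simp add: regular_module_def)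
  have "carrier (regular_module R) = carrier R"
    by (simp add: regular_module_def)
  then have up: "up (regular_module R) = up R"
    by (simp only: up_def zero)
  have mult: "f \<cdot>\<^bsub>skew_poly_module (regular_module R) \<sigma>\<^esub> g = f \<otimes>\<^bsub>S\<^esub> g" for f g
    by (simp add: skew_poly_module_simps skew_poly_ring_simps fs) (simp add: regular_module_def)
  have add: "f \<oplus>\<^bsub>skew_poly_module (regular_module R) \<sigma>\<^esub> g = f \<oplus>\<^bsub>S\<^esub> g" for f g
    by (simp add: skew_poly_module_simps skew_poly_ring_simps regular_module_def)
  note reg = reg.skew_ract_closed reg.skew_ract_l_distr reg.skew_ract_r_distr reg.skew_ract_assoc
  note reg = reg[unfolded up mult add]
  show ?thesis
  proof (rule ringI)
    show "abelian_group S"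
      by (rule abelian_group_up[OF R.abelian_group_axioms]) (simp_all add: skew_poly_ring_simps)
    have one: "\<one>\<^bsub>S\<^esub> \<in> up R"
      by (auto simp: skew_poly_ring_simps up_iff intro!: exI[of _ 0])
    have l: "\<one>\<^bsub>S\<^esub> \<otimes>\<^bsub>S\<^esub> f = f" if "f \<in> up R" for f
      using reg.monomial_ract[of "\<one>\<^bsub>R\<^esub>" f 0] that
      unfolding mult zero up
      by (simp add: regular_module_def skew_poly_ring_simps)
    have r: "f \<otimes>\<^bsub>S\<^esub> \<one>\<^bsub>S\<^esub> = f" if "f \<in> up R" for f
      using reg.skew_ract_const[of f "\<one>\<^bsub>R\<^esub>"] that
      unfolding mult zero up
      by (simp add: sigma_pow_simps) (simp add: regular_module_def skew_poly_ring_simps)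
    show "monoid S"
      using one l r reg by (intro monoidI) (auto simp: skew_poly_ring_simps(1))
  qed (use reg in \<open>auto simp: skew_poly_ring_simps(1)\<close>)
qed

lemma Mx_module: "right_module S Mx"
proof (intro right_module.intro right_module_axioms.intro ring_S)
  show "abelian_group Mx"
    by (rule abelian_group_up[OF M.abelian_group_axioms]) (simp_all add: skew_poly_module_simps)
  show "f \<cdot>\<^bsub>Mx\<^esub> \<one>\<^bsub>S\<^esub> = f" if "f \<in> carrier Mx" for f
    using skew_ract_const[of f "\<one>\<^bsub>R\<^esub>"] that
    by (simp add: skew_poly_ring_simps skew_poly_module_simps(1) sigma_pow_simps ract_one)
qed (simp_all only: skew_poly_ring_simps(1) skew_poly_module_simps(1) skew_ract_closed
    skew_ract_l_distr skew_ract_r_distr skew_ract_assoc)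

text \<open>Acting by \<open>g\<close> on a monomial m x^n produces the coefficients m
  \<sigma>^n(g_i). Letting \<open>m\<close> and \<open>n\<close> vary gives the core of the
  annihilator; conversely, these conditions kill every summand of the convolution.\<close>

lemma annihilator_Mx:
  "annihilator S Mx = skew_poly_ideal R (sigma_core R \<sigma> (annihilator R M))"
proof (intro equalityI subsetI)
  fix g assume "g \<in> annihilator S Mx"
  then have g: "g \<in> up R" and z: "\<And>f. f \<in> up M \<Longrightarrow> f \<cdot>\<^bsub>Mx\<^esub> g = (\<lambda>n. \<zero>\<^bsub>M\<^esub>)"
    by (auto simp: annihilator_def skew_poly_ring_simps skew_poly_module_simps(1,2))
  have "m \<cdot>\<^bsub>M\<^esub> (\<sigma> ^^ n) (g i) = \<zero>\<^bsub>M\<^esub>" if "m \<in> carrier M" for m n i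
    using z[OF monomial_up[OF that, of n], THEN fun_cong, of "n + i"]
    unfolding monomial_ract[OF that g] by simp
  then show "g \<in> skew_poly_ideal R (sigma_core R \<sigma> (annihilator R M))"
    using g by (auto simp: skew_poly_ideal_def sigma_core_def pow_preimage_def annihilator_def)
next
  fix g assume "g \<in> skew_poly_ideal R (sigma_core R \<sigma> (annihilator R M))"
  then show "g \<in> annihilator S Mx"
    by (auto simp: skew_poly_ideal_def sigma_core_def pow_preimage_def annihilator_def
        skew_poly_ring_simps skew_poly_module_simps fun_eq_iff intro!: M.add.finprod_one_eqI)
qed

end

section \<open>Associated primes and twists\<close>

text \<open>The image of \<open>A\<close> is a nonzero submodule of the prime module
  \<open>B\<close>, hence prime with the annihilator of \<open>B\<close>.\<close>

lemma embedding_prime: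
  assumes "semilinear_embedding R A R B id \<phi>" "prime_module R B" "carrier A \<noteq> {\<zero>\<^bsub>A\<^esub>}"
  shows "prime_module R A" "annihilator R A = annihilator R B"
proof -
  interpret A: right_module R A using assms(1) by (simp add: semilinear_embedding_def)
  interpret B: right_module R B using assms(1) by (simp add: semilinear_embedding_def)
  note im = semilinear_embedding_image[OF assms(1)]
  obtain m where m: "m \<in> carrier A" "m \<noteq> \<zero>\<^bsub>A\<^esub>"
    using assms(3) A.M.zero_closed by blast
  have "\<phi> m \<noteq> \<zero>\<^bsub>B\<^esub>"
    using assms(1) m inj_on_eq_iff[of \<phi> "carrier A" m "\<zero>\<^bsub>A\<^esub>"] A.M.zero_closed
    unfolding semilinear_embedding_def by metis
  then have nz: "\<phi> ` carrier A \<noteq> {\<zero>\<^bsub>B\<^esub>}" using m(1) by auto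
  show "prime_module R A"
    using im(3) B.prime_submodule[OF assms(2) im(1) nz] by blast
  show "annihilator R A = annihilator R B"
  proof -
    have "annihilator R (B\<lparr>carrier := \<phi> ` carrier A\<rparr>) = annihilator R B"
      using im(1) assms(2) nz unfolding prime_module_def by blast
    then show ?thesis unfolding im(2) by (auto simp: annihilator_def)
  qed
qed

text \<open>Produces associated primes: the image of \<open>A\<close> serves as the required prime
  submodule.\<close>

lemma embedding_Ass:
  assumes "semilinear_embedding R A R B id \<phi>" "prime_module R A"
  shows "annihilator R A \<in> Ass R B"
proof -
  note im = semilinear_embedding_image[OF assms(1)]
  have "annihilator R A = annihilator R (B\<lparr>carrier := \<phi> ` carrier A\<rparr>)"
    unfolding im(2) by (auto simp: annihilator_def)
  then show ?thesis
    using im(1,3) assms(2) unfolding Ass_def by blast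
qed

lemma (in abelian_monoid) finsum_shift:
  assumes "\<And>i. F i \<in> carrier G" "\<And>i. i < k \<Longrightarrow> F i = \<zero>"
  shows "(\<Oplus>i\<in>{..k + l}. F i) = (\<Oplus>i\<in>{..l::nat}. F (k + i))"
proof (induction l)
  case 0
  then show ?case using assms finsum_single[of F k k] by (simp add: Pi_def)
qed (use assms in \<open>simp add: finsum_Suc Pi_def\<close>)

lemma finsum_twist: "finsum (twist \<sigma> k M) = finsum M"
  by (simp add: finsum_def twist_def)

lemma twist_simps:
  "carrier (twist \<sigma> k M) = carrier M" "\<zero>\<^bsub>twist \<sigma> k M\<^esub> = \<zero>\<^bsub>M\<^esub>"
  "m \<oplus>\<^bsub>twist \<sigma> k M\<^esub> n = m \<oplus>\<^bsub>M\<^esub> n" "m \<cdot>\<^bsub>twist \<sigma> k M\<^esub> r = m \<cdot>\<^bsub>M\<^esub> (\<sigma> ^^ k) r"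
  by (simp_all add: twist_def)

lemma up_twist: "up (twist \<sigma> k M) = up M"
  by (simp add: up_def twist_def)

lemma twist_submodule: "(twist \<sigma> k M)\<lparr>carrier := N\<rparr> = twist \<sigma> k (M\<lparr>carrier := N\<rparr>)"
  by (simp add: twist_def)

section \<open>Inclusions and shifts between induced modules\<close>

context skew_module
begin

lemma up_trivial_iff: "up M = {\<lambda>n. \<zero>\<^bsub>M\<^esub>} \<longleftrightarrow> carrier M = {\<zero>\<^bsub>M\<^esub>}"
proof
  assume up: "up M = {\<lambda>n. \<zero>\<^bsub>M\<^esub>}"
  have "m = \<zero>\<^bsub>M\<^esub>" if "m \<in> carrier M" for m
  proof -
    have "(\<lambda>i::nat. if i = 0 then m else \<zero>\<^bsub>M\<^esub>) = (\<lambda>n. \<zero>\<^bsub>M\<^esub>)"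
      using monomial_up[OF that, of 0] unfolding up by (rule singletonD)
    from fun_cong[OF this, of 0] show ?thesis by simp
  qed
  then show "carrier M = {\<zero>\<^bsub>M\<^esub>}" by auto
qed (auto simp: up_iff)

lemma twist_skew_module: "skew_module R (twist \<sigma> k M) \<sigma>"
proof -
  have "abelian_group (twist \<sigma> k M)"
    by (rule abelian_groupI)
      (auto simp: twist_simps M.a_assoc intro: M.a_comm bexI[of _ "\<ominus>\<^bsub>M\<^esub> m" for m] M.l_neg)
  then show ?thesis
    by (intro skew_module.intro right_module.intro right_module_axioms.intro
        skew_module_axioms.intro sigma_hom R.ring_axioms)
      (auto simp: twist_simps ract_closed ract_l_distr ract_r_distr ract_assoc ract_one
        sigma_pow_simps)
qed

lemma submodule_skew_module:
  "right_submodule N R M \<Longrightarrow> skew_module R (M\<lparr>carrier := N\<rparr>) \<sigma>"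
  by (intro skew_module.intro right_submodule_module skew_module_axioms.intro sigma_hom)

lemma annihilator_twist: "annihilator R (twist \<sigma> k M) = pow_preimage R \<sigma> k (annihilator R M)"
  by (auto simp: annihilator_def pow_preimage_def twist_simps)

text \<open>The induced module of \<open>N\<close> is a subset of that of \<open>M\<close>, so both
  maps are \<open>id\<close>; the content is that sums formed in the two records agree.\<close>

lemma inclusion_embedding:
  assumes "right_submodule N R M"
  shows "semilinear_embedding S (skew_poly_module (M\<lparr>carrier := N\<rparr>) \<sigma>) S Mx id id"
proof -
  interpret N: skew_module R "M\<lparr>carrier := N\<rparr>" \<sigma>
    by (rule submodule_skew_module[OF assms])
  have fs: "finsum (M\<lparr>carrier := N\<rparr>) F {..n::nat} = finsum M F {..n}" if "\<And>i. F i \<in> N" for F n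
    using that right_submodule_sub[OF assms]
    by (induction n) (simp_all add: Pi_def M.finsum_Suc N.M.finsum_Suc)
  have "f \<cdot>\<^bsub>skew_poly_module (M\<lparr>carrier := N\<rparr>) \<sigma>\<^esub> g = f \<cdot>\<^bsub>Mx\<^esub> g"
    if "f \<in> up (M\<lparr>carrier := N\<rparr>)" "g \<in> up R" for f g
    unfolding skew_poly_module_simps using that N.ract_closed
    by (intro ext, subst fs) (auto simp: up_iff)
  then show ?thesis
    using N.Mx_module Mx_module right_submodule_sub[OF assms]
    by (auto simp: semilinear_embedding_def skew_poly_module_simps(1-3) skew_poly_ring_simps(1)
        up_iff)
qed

text \<open>The shift of m x^i to m x^(i+k). On the target \<open>r\<close> acts on this term
  through \<sigma>^(i+k), and the extra power \<sigma>^k is what the twist on the source accounts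
  for.\<close>

lemma shift_embedding:
  "semilinear_embedding S (skew_poly_module (twist \<sigma> k M) \<sigma>) S Mx id
     (\<lambda>f n. if n < k then \<zero>\<^bsub>M\<^esub> else f (n - k))"
  (is "semilinear_embedding S ?T S Mx id ?\<phi>")
proof -
  interpret T: skew_module R "twist \<sigma> k M" \<sigma>
    by (rule twist_skew_module)
  have up: "?\<phi> f \<in> up M" if f: "f \<in> up M" for f
  proof -
    obtain a where "\<And>n. n > a \<Longrightarrow> f n = \<zero>\<^bsub>M\<^esub>" using up_boundE[OF f] by blast
    then show ?thesis using f by (auto simp: up_iff intro!: exI[of _ "a + k"])
  qed
  have inj: "inj_on ?\<phi> (up M)"
  proof (rule inj_onI, rule ext)
    fix f g n assume "?\<phi> f = ?\<phi> g"
    from fun_cong[OF this, of "n + k"] show "f n = g n" by simp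
  qed
  have "?\<phi> (f \<cdot>\<^bsub>?T\<^esub> g) = ?\<phi> f \<cdot>\<^bsub>Mx\<^esub> g" if f: "f \<in> up M" and g: "g \<in> up R" for f g
  proof
    fix n
    show "?\<phi> (f \<cdot>\<^bsub>?T\<^esub> g) n = (?\<phi> f \<cdot>\<^bsub>Mx\<^esub> g) n"
    proof (cases "n < k")
      case True
      then show ?thesis
        using g by (auto simp: skew_poly_module_simps zero_ract intro!: M.add.finprod_one_eqI[symmetric])
    next
      case False
      then obtain l where l: "n = k + l" by (metis le_add_diff_inverse not_less)
      have "(?\<phi> f \<cdot>\<^bsub>Mx\<^esub> g) n = (\<Oplus>\<^bsub>M\<^esub>i\<in>{..l}. ?\<phi> f (k + i) \<cdot>\<^bsub>M\<^esub> (\<sigma> ^^ (k + i)) (g (n - (k + i))))"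
        unfolding l skew_poly_module_simps using f g up[OF f]
        by (intro M.finsum_shift) (auto simp: zero_ract ract_closed)
      also have "\<dots> = ?\<phi> (f \<cdot>\<^bsub>?T\<^esub> g) n"
        by (simp add: l skew_poly_module_simps finsum_twist twist_simps funpow_add)
      finally show ?thesis ..
    qed
  qed
  then show ?thesis
    using T.Mx_module Mx_module up inj
    by (auto simp: semilinear_embedding_def skew_poly_module_simps(1-3) skew_poly_ring_simps(1)
        up_twist twist_simps)
qed

text \<open>Both sides are annihilators over \<open>S\<close>, of the modules induced from the twist
  and from \<open>M\<close>. The shift embeds the first in the second, which is prime.\<close>

lemma S_prime_annihilator:
  assumes "S_prime R \<sigma> M"
  shows "skew_poly_ideal R (sigma_core R \<sigma> (pow_preimage R \<sigma> k (annihilator R M)))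
    = skew_poly_ideal R (sigma_core R \<sigma> (annihilator R M))"
proof -
  interpret T: skew_module R "twist \<sigma> k M" \<sigma>
    by (rule twist_skew_module)
  have "annihilator S T.Mx = annihilator S Mx"
    using assms by (intro embedding_prime(2)[OF shift_embedding])
      (auto simp: S_prime_def prime_module_def skew_poly_module_simps up_twist twist_simps)
  then show ?thesis
    by (simp add: annihilator_Mx T.annihilator_Mx annihilator_twist)
qed

text \<open>The element \<open>f\<close> of least support is compared with the generator
  \<open>?a\<close> of the module induced from \<open>?L\<close>: \<open>iff\<close> shows that the
  same \<open>g\<close> kill both, and \<open>cyclic_prime_transfer\<close> then moves primeness and
  annihilator across.\<close>

lemma S_prime_cyclic:
  assumes N: "right_submodule N S Mx" and prime: "prime_module S (Mx\<lparr>carrier := N\<rparr>)"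
  obtains k m where "m \<in> carrier M"
    "S_prime R \<sigma> ((twist \<sigma> k M)\<lparr>carrier := (\<lambda>r. m \<cdot>\<^bsub>twist \<sigma> k M\<^esub> r) ` carrier R\<rparr>)"
    "annihilator S (skew_poly_module ((twist \<sigma> k M)\<lparr>carrier := (\<lambda>r. m \<cdot>\<^bsub>twist \<sigma> k M\<^esub> r) ` carrier R\<rparr>) \<sigma>)
      = annihilator S (Mx\<lparr>carrier := N\<rparr>)"
proof -
  interpret Mx: right_module S Mx by (rule Mx_module)
  interpret N: right_module S "Mx\<lparr>carrier := N\<rparr>" by (rule Mx.right_submodule_module[OF N])
  have Nup: "f \<in> up M" if "f \<in> N" for f
    using Mx.right_submodule_sub[OF N that] by (simp add: skew_poly_module_simps)
  have z: "\<zero>\<^bsub>Mx\<^esub> = (\<lambda>n. \<zero>\<^bsub>M\<^esub>)" by (simp add: skew_poly_module_simps)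
  have "\<exists>f. f \<in> N \<and> f \<noteq> \<zero>\<^bsub>Mx\<^esub>"
    using prime N.M.zero_closed by (auto simp: prime_module_def)
  then obtain f where f: "f \<in> N" "f \<noteq> \<zero>\<^bsub>Mx\<^esub>"
    and min: "\<And>p. p \<in> N \<Longrightarrow> p \<noteq> \<zero>\<^bsub>Mx\<^esub> \<Longrightarrow> card {n. f n \<noteq> \<zero>\<^bsub>M\<^esub>} \<le> card {n. p n \<noteq> \<zero>\<^bsub>M\<^esub>}"
    using ex_has_least_nat[of "\<lambda>f. f \<in> N \<and> f \<noteq> \<zero>\<^bsub>Mx\<^esub>" _ "\<lambda>f. card {n. f n \<noteq> \<zero>\<^bsub>M\<^esub>}"] by metis
  define k where "k = (LEAST n. f n \<noteq> \<zero>\<^bsub>M\<^esub>)"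
  have "\<exists>n. f n \<noteq> \<zero>\<^bsub>M\<^esub>" using f(2) by (auto simp: z)
  then have fk: "f k \<noteq> \<zero>\<^bsub>M\<^esub>" unfolding k_def by (rule LeastI_ex)
  have below: "f n = \<zero>\<^bsub>M\<^esub>" if "n < k" for n
    using that not_less_Least unfolding k_def by blast
  \<comment> \<open>Acting by \<open>r\<close> cannot enlarge the support and removes the index
    \<open>k\<close> from it, so minimality leaves only the zero element.\<close>
  have kill: "f n \<cdot>\<^bsub>M\<^esub> (\<sigma> ^^ n) r = \<zero>\<^bsub>M\<^esub>"
    if r: "r \<in> carrier R" and 0: "f k \<cdot>\<^bsub>M\<^esub> (\<sigma> ^^ k) r = \<zero>\<^bsub>M\<^esub>" for r n
  proof -
    define p where "p = f \<cdot>\<^bsub>Mx\<^esub> (\<lambda>n. if n = 0 then r else \<zero>\<^bsub>R\<^esub>)"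
    have p: "p = (\<lambda>n. f n \<cdot>\<^bsub>M\<^esub> (\<sigma> ^^ n) r)"
      unfolding p_def using r Nup[OF f(1)] by (rule skew_ract_const[rotated])
    have "(\<lambda>n. if n = 0 then r else \<zero>\<^bsub>R\<^esub>) \<in> carrier S"
      using r by (auto simp: skew_poly_ring_simps up_iff intro!: exI[of _ 0])
    then have "p \<in> N" using N f(1) unfolding p_def right_submodule_def by blast
    moreover have "card {n. p n \<noteq> \<zero>\<^bsub>M\<^esub>} < card {n. f n \<noteq> \<zero>\<^bsub>M\<^esub>}"
    proof (rule psubset_card_mono)
      obtain a where "\<And>n. n > a \<Longrightarrow> f n = \<zero>\<^bsub>M\<^esub>" using up_boundE[OF Nup[OF f(1)]] by blast
      then have "{n. f n \<noteq> \<zero>\<^bsub>M\<^esub>} \<subseteq> {..a}" by (auto simp: not_less[symmetric])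
      then show "finite {n. f n \<noteq> \<zero>\<^bsub>M\<^esub>}" by (rule finite_subset) simp
      show "{n. p n \<noteq> \<zero>\<^bsub>M\<^esub>} \<subset> {n. f n \<noteq> \<zero>\<^bsub>M\<^esub>}"
        using fk 0 r by (auto simp: p zero_ract)
    qed
    ultimately have "p = \<zero>\<^bsub>Mx\<^esub>" using min[of p] by (meson not_less)
    then show ?thesis unfolding p z by (rule fun_cong)
  qed
  let ?T = "twist \<sigma> k M"
  let ?L = "?T\<lparr>carrier := (\<lambda>r. f k \<cdot>\<^bsub>?T\<^esub> r) ` carrier R\<rparr>"
  interpret T: skew_module R ?T \<sigma> by (rule twist_skew_module)
  have m: "f k \<in> carrier M" using Nup[OF f(1)] by simp
  have L: "right_submodule ((\<lambda>r. f k \<cdot>\<^bsub>?T\<^esub> r) ` carrier R) R ?T"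
    using m by (intro T.right_submodule_cyclic) (simp add: twist_simps)
  interpret L: skew_module R ?L \<sigma> by (rule T.submodule_skew_module[OF L])
  have mL: "f k \<in> carrier ?L"
    using m by (auto intro!: image_eqI[of _ _ "\<one>\<^bsub>R\<^esub>"] simp: twist_simps sigma_pow_simps ract_one)
  \<comment> \<open>The lowest coefficient is placed in degree 0; its original degree
    \<open>k\<close> survives only in the twist.\<close>
  let ?a = "\<lambda>i. if i = 0 then f k else \<zero>\<^bsub>M\<^esub>"
  have zL: "\<zero>\<^bsub>?L\<^esub> = \<zero>\<^bsub>M\<^esub>" by (simp add: twist_simps)
  have a: "?a \<in> up ?L" using L.monomial_up[OF mL, of 0] unfolding zL .
  have act: "?a \<cdot>\<^bsub>L.Mx\<^esub> g = (\<lambda>i. f k \<cdot>\<^bsub>M\<^esub> (\<sigma> ^^ k) (g i))" if "g \<in> up R" for g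
    using L.monomial_ract[OF mL that, of 0] unfolding zL by (simp add: twist_simps)
  have gen: "up ?L = (\<lambda>g. ?a \<cdot>\<^bsub>L.Mx\<^esub> g) ` up R"
  proof
    show "(\<lambda>g. ?a \<cdot>\<^bsub>L.Mx\<^esub> g) ` up R \<subseteq> up ?L"
      using L.skew_ract_closed[OF a] by auto
    show "up ?L \<subseteq> (\<lambda>g. ?a \<cdot>\<^bsub>L.Mx\<^esub> g) ` up R"
    proof
      fix h assume h: "h \<in> up ?L"
      \<comment> \<open>The last clause makes the chosen scalars vanish wherever \<open>h\<close>
        does, so that \<open>g\<close> has finite support.\<close>
      have "\<exists>r. r \<in> carrier R \<and> h i = f k \<cdot>\<^bsub>M\<^esub> (\<sigma> ^^ k) r \<and> (h i = \<zero>\<^bsub>M\<^esub> \<longrightarrow> r = \<zero>\<^bsub>R\<^esub>)" for i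
      proof (cases "h i = \<zero>\<^bsub>M\<^esub>")
        case True
        then show ?thesis using m by (auto simp: ract_zero sigma_pow_simps)
      next
        case False
        then show ?thesis using h by (auto simp: up_iff twist_simps)
      qed
      then obtain g where g: "\<And>i. g i \<in> carrier R" "\<And>i. h i = f k \<cdot>\<^bsub>M\<^esub> (\<sigma> ^^ k) (g i)"
        "\<And>i. h i = \<zero>\<^bsub>M\<^esub> \<Longrightarrow> g i = \<zero>\<^bsub>R\<^esub>" by metis
      obtain b where "\<And>n. n > b \<Longrightarrow> h n = \<zero>\<^bsub>?L\<^esub>" using up_boundE[OF h] by blast
      then have "g \<in> up R" using g by (auto simp: up_iff zL intro!: exI[of _ b])
      moreover have "h = ?a \<cdot>\<^bsub>L.Mx\<^esub> g" using act[OF \<open>g \<in> up R\<close>] g(2) by auto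
      ultimately show "h \<in> (\<lambda>g. ?a \<cdot>\<^bsub>L.Mx\<^esub> g) ` up R" by blast
    qed
  qed
  have iff: "?a \<cdot>\<^bsub>L.Mx\<^esub> g = \<zero>\<^bsub>L.Mx\<^esub> \<longleftrightarrow> f \<cdot>\<^bsub>Mx\<^esub> g = \<zero>\<^bsub>Mx\<^esub>" if g: "g \<in> up R" for g
  proof
    assume "?a \<cdot>\<^bsub>L.Mx\<^esub> g = \<zero>\<^bsub>L.Mx\<^esub>"
    then have "f k \<cdot>\<^bsub>M\<^esub> (\<sigma> ^^ k) (g i) = \<zero>\<^bsub>M\<^esub>" for i
      unfolding act[OF g] by (auto simp: skew_poly_module_simps twist_simps dest: fun_cong)
    then show "f \<cdot>\<^bsub>Mx\<^esub> g = \<zero>\<^bsub>Mx\<^esub>"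
      using kill g unfolding skew_poly_module_simps
      by (intro ext M.add.finprod_one_eqI) auto
  next
    assume fg: "f \<cdot>\<^bsub>Mx\<^esub> g = \<zero>\<^bsub>Mx\<^esub>"
    \<comment> \<open>In degree \<open>k + n\<close> the coefficients of \<open>f\<close> below
      \<open>k\<close> are zero, while those above \<open>k\<close> meet coefficients of
      \<open>g\<close> of index less than \<open>n\<close>, which the induction hypothesis and
      \<open>kill\<close> make harmless. One term remains.\<close>
    have "f k \<cdot>\<^bsub>M\<^esub> (\<sigma> ^^ k) (g n) = \<zero>\<^bsub>M\<^esub>" for n
    proof (induction n rule: less_induct)
      case (less n)
      have "(f \<cdot>\<^bsub>Mx\<^esub> g) (k + n) = f k \<cdot>\<^bsub>M\<^esub> (\<sigma> ^^ k) (g (k + n - k))"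
        unfolding skew_poly_module_simps
      proof (rule M.finsum_single)
        fix i assume i: "i \<le> k + n" "i \<noteq> k"
        show "f i \<cdot>\<^bsub>M\<^esub> (\<sigma> ^^ i) (g (k + n - i)) = \<zero>\<^bsub>M\<^esub>"
        proof (cases "i < k")
          case True
          then show ?thesis using below g by (simp add: zero_ract)
        next
          case False
          then have "k + n - i < n" using i by simp
          then show ?thesis by (rule kill[OF upR_closed[OF g] less])
        qed
      qed (use g m in \<open>auto intro: ract_closed\<close>)
      then show ?case using fg by (simp add: z)
    qed
    then show "?a \<cdot>\<^bsub>L.Mx\<^esub> g = \<zero>\<^bsub>L.Mx\<^esub>"
      unfolding act[OF g] by (simp add: skew_poly_module_simps twist_simps)
  qed
  have c1: "?a \<in> carrier L.Mx" using a by (simp only: skew_poly_module_simps(1))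
  have c2: "carrier L.Mx = (\<lambda>g. ?a \<cdot>\<^bsub>L.Mx\<^esub> g) ` carrier S"
    using gen by (simp only: skew_poly_module_simps(1) skew_poly_ring_simps(1))
  have c3: "f \<in> carrier (Mx\<lparr>carrier := N\<rparr>)" "f \<noteq> \<zero>\<^bsub>Mx\<lparr>carrier := N\<rparr>\<^esub>"
    using f by simp_all
  have c4: "?a \<cdot>\<^bsub>L.Mx\<^esub> g = \<zero>\<^bsub>L.Mx\<^esub> \<longleftrightarrow>
      f \<cdot>\<^bsub>Mx\<lparr>carrier := N\<rparr>\<^esub> g = \<zero>\<^bsub>Mx\<lparr>carrier := N\<rparr>\<^esub>" if "g \<in> carrier S" for g
  proof -
    have "f \<cdot>\<^bsub>Mx\<lparr>carrier := N\<rparr>\<^esub> g = f \<cdot>\<^bsub>Mx\<^esub> g" "\<zero>\<^bsub>Mx\<lparr>carrier := N\<rparr>\<^esub> = \<zero>\<^bsub>Mx\<^esub>"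
      by simp_all
    then show ?thesis using iff that by (simp only: skew_poly_ring_simps(1))
  qed
  note transfer = cyclic_prime_transfer[OF L.Mx_module N.right_module_axioms prime c1 c2 c3 c4]
  show thesis
    by (rule that[of "f k" k]) (use m transfer in \<open>simp_all only: S_prime_def\<close>)
qed

text \<open>One inclusion is \<open>S_prime_cyclic\<close>; the other composes the inclusion of the
  module induced from \<open>L\<close> with the shift by \<open>k\<close>. The core of
  \<open>J\<close> itself appears here, because \<open>J\<close> is taken for the twisted
  action.\<close>

lemma Ass_Mx:
  "Ass S Mx = {skew_poly_ideal R (sigma_core R \<sigma> J) | k J.
     J \<in> S_prime_annihilators R \<sigma> (twist \<sigma> k M)}" (is "_ = ?r")
proof (intro equalityI subsetI)
  fix Q assume "Q \<in> Ass S Mx"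
  then obtain N where N: "right_submodule N S Mx" "prime_module S (Mx\<lparr>carrier := N\<rparr>)"
    and Q: "Q = annihilator S (Mx\<lparr>carrier := N\<rparr>)"
    by (auto simp: Ass_def)
  obtain k m where m: "m \<in> carrier M"
    and prime: "S_prime R \<sigma> ((twist \<sigma> k M)\<lparr>carrier := (\<lambda>r. m \<cdot>\<^bsub>twist \<sigma> k M\<^esub> r) ` carrier R\<rparr>)"
    and ann: "annihilator S (skew_poly_module ((twist \<sigma> k M)\<lparr>carrier := (\<lambda>r. m \<cdot>\<^bsub>twist \<sigma> k M\<^esub> r) ` carrier R\<rparr>) \<sigma>)
      = annihilator S (Mx\<lparr>carrier := N\<rparr>)"
    by (rule S_prime_cyclic[OF N])
  interpret T: skew_module R "twist \<sigma> k M" \<sigma> by (rule twist_skew_module)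
  have L: "right_submodule ((\<lambda>r. m \<cdot>\<^bsub>twist \<sigma> k M\<^esub> r) ` carrier R) R (twist \<sigma> k M)"
    using m by (intro T.right_submodule_cyclic) (simp add: twist_simps)
  interpret L: skew_module R "(twist \<sigma> k M)\<lparr>carrier := (\<lambda>r. m \<cdot>\<^bsub>twist \<sigma> k M\<^esub> r) ` carrier R\<rparr>" \<sigma>
    by (rule T.submodule_skew_module[OF L])
  show "Q \<in> ?r"
    using L prime unfolding Q ann[symmetric] L.annihilator_Mx S_prime_annihilators_def by blast
next
  fix Q assume "Q \<in> ?r"
  then obtain k L where L: "right_submodule L R (twist \<sigma> k M)"
    and prime: "S_prime R \<sigma> ((twist \<sigma> k M)\<lparr>carrier := L\<rparr>)"
    and Q: "Q = skew_poly_ideal R (sigma_core R \<sigma> (annihilator R ((twist \<sigma> k M)\<lparr>carrier := L\<rparr>)))"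
    by (auto simp: S_prime_annihilators_def)
  interpret T: skew_module R "twist \<sigma> k M" \<sigma> by (rule twist_skew_module)
  interpret L: skew_module R "(twist \<sigma> k M)\<lparr>carrier := L\<rparr>" \<sigma>
    by (rule T.submodule_skew_module[OF L])
  show "Q \<in> Ass S Mx"
    using embedding_Ass semilinear_embedding_comp[OF T.inclusion_embedding[OF L] shift_embedding]
      prime
    unfolding Q L.annihilator_Mx[symmetric] S_prime_def by (simp only: id_o o_id) blast
qed

text \<open>Allows a preimage to be inserted, as in the general description, or dropped, as for
  surjective \<sigma>, where twisting turns annihilators into preimages.\<close>

lemma S_prime_annihilator_core:
  assumes "J \<in> S_prime_annihilators R \<sigma> M"
  shows "skew_poly_ideal R (sigma_core R \<sigma> (pow_preimage R \<sigma> k J)) =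
    skew_poly_ideal R (sigma_core R \<sigma> J)"
  using assms skew_module.S_prime_annihilator[OF submodule_skew_module]
  by (auto simp: S_prime_annihilators_def)

lemma Ass_Mx_preimage:
  "Ass S Mx = {skew_poly_ideal R (sigma_core R \<sigma> (pow_preimage R \<sigma> k J)) | k J.
     J \<in> S_prime_annihilators R \<sigma> (twist \<sigma> k M)}"
  unfolding Ass_Mx
  using skew_module.S_prime_annihilator_core[OF twist_skew_module] by (metis (no_types, lifting))

end

section \<open>Surjective endomorphisms and the chain condition\<close>

lemma acc_maximal:
  assumes acc: "acc_on_ideals R" and ne: "\<I> \<noteq> {}" and ideals: "\<And>I. I \<in> \<I> \<Longrightarrow> ideal I R"
  shows "\<exists>I\<in>\<I>. \<forall>J\<in>\<I>. I \<subseteq> J \<longrightarrow> J = I"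
proof (rule ccontr)
  assume "\<not> ?thesis"
  then have bigger: "\<exists>J. J \<in> \<I> \<and> I \<subset> J" if "I \<in> \<I>" for I
    using that by blast
  have "\<exists>I. \<forall>n. I n \<in> \<I> \<and> I n \<subset> I (Suc n)"
    by (rule dependent_nat_choice) (use ne bigger in auto)
  then obtain I where I: "\<And>n. I n \<in> \<I>" "\<And>n::nat. I n \<subset> I (Suc n)"
    by blast
  have "(\<forall>n. ideal (I n) R) \<and> (\<forall>n. I n \<subseteq> I (Suc n))"
    using I ideals by blast
  then obtain N where "\<And>n. n \<ge> N \<Longrightarrow> I n = I N"
    using acc unfolding acc_on_ideals_def by meson
  from this[of "Suc N"] I(2)[of N] show False by auto
qed

text \<open>A nonzero submodule whose annihilator is maximal among those of nonzero submodules is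
  prime, because passing to a smaller submodule can only enlarge the annihilator.\<close>

lemma (in right_module) prime_submodule_exists:
  assumes "acc_on_ideals R" "carrier M \<noteq> {\<zero>\<^bsub>M\<^esub>}"
  obtains N where "right_submodule N R M" "N \<noteq> {\<zero>\<^bsub>M\<^esub>}" "prime_module R (M\<lparr>carrier := N\<rparr>)"
proof -
  let ?sub = "\<lambda>N. right_submodule N R M \<and> N \<noteq> {\<zero>\<^bsub>M\<^esub>}"
  let ?\<I> = "{annihilator R (M\<lparr>carrier := N\<rparr>) | N. ?sub N}"
  have "?\<I> \<noteq> {}" using right_submodule_self assms(2) by blast
  moreover have "ideal I R" if "I \<in> ?\<I>" for I
    using that right_module.annihilator_ideal[OF right_submodule_module] by blast
  ultimately have "\<exists>P\<in>?\<I>. \<forall>J\<in>?\<I>. P \<subseteq> J \<longrightarrow> J = P"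
    by (rule acc_maximal[OF assms(1)])
  then obtain P where "P \<in> ?\<I>" and max: "\<And>J. J \<in> ?\<I> \<Longrightarrow> P \<subseteq> J \<Longrightarrow> J = P"
    by meson
  then obtain N where N: "?sub N" and P: "P = annihilator R (M\<lparr>carrier := N\<rparr>)" by blast
  have "annihilator R (M\<lparr>carrier := K\<rparr>) = annihilator R (M\<lparr>carrier := N\<rparr>)"
    if K: "right_submodule K R (M\<lparr>carrier := N\<rparr>)" "K \<noteq> {\<zero>\<^bsub>M\<^esub>}" for K
  proof (rule max[unfolded P])
    show "annihilator R (M\<lparr>carrier := K\<rparr>) \<in> ?\<I>"
      using right_submodule_trans[OF _ K(1)] N K(2) by blast
    have "K \<subseteq> N"
      using right_module.right_submodule_sub[OF right_submodule_module K(1)] N by auto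
    then show "annihilator R (M\<lparr>carrier := N\<rparr>) \<subseteq> annihilator R (M\<lparr>carrier := K\<rparr>)"
      by (auto simp: annihilator_def)
  qed
  then show thesis using N by (intro that[of N]) (auto simp: prime_module_def)
qed

section \<open>Surjective \<sigma>: twists as changes of scalars\<close>

context skew_module
begin

lemma sigma_pow_surj:
  assumes "\<sigma> ` carrier R = carrier R" shows "(\<sigma> ^^ k) ` carrier R = carrier R"
proof (induction k)
  case (Suc k)
  then show ?case using assms by (simp flip: image_image)
qed simp

lemma sigma_pow_sigma_pow: "(\<sigma> ^^ m) ((\<sigma> ^^ n) r) = (\<sigma> ^^ (n + m)) r"
  by (metis add.commute comp_apply funpow_add)

lemma coefficientwise_surj:
  assumes "\<sigma> ` carrier R = carrier R"
  shows "(\<lambda>g n. (\<sigma> ^^ k) (g n)) ` up R = up R"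
proof (intro equalityI subsetI)
  fix h assume "h \<in> (\<lambda>g n. (\<sigma> ^^ k) (g n)) ` up R"
  then show "h \<in> up R" by (auto simp: up_iff) (metis sigma_pow_simps(3))
next
  fix h assume h: "h \<in> up R"
  \<comment> \<open>Zero coefficients are lifted to zero, so that the lifted sequence stays finitely
    supported.\<close>
  have "\<exists>r. r \<in> carrier R \<and> h n = (\<sigma> ^^ k) r \<and> (h n = \<zero>\<^bsub>R\<^esub> \<longrightarrow> r = \<zero>\<^bsub>R\<^esub>)" for n
  proof (cases "h n = \<zero>\<^bsub>R\<^esub>")
    case False
    have "h n \<in> (\<sigma> ^^ k) ` carrier R" using h sigma_pow_surj[OF assms] by simp
    with False show ?thesis by auto
  qed (auto simp: sigma_pow_simps)
  then obtain g where g: "\<And>n. g n \<in> carrier R" "\<And>n. h n = (\<sigma> ^^ k) (g n)"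
    "\<And>n. h n = \<zero>\<^bsub>R\<^esub> \<Longrightarrow> g n = \<zero>\<^bsub>R\<^esub>" by metis
  obtain b where "\<And>n. n > b \<Longrightarrow> h n = \<zero>\<^bsub>R\<^esub>" using up_boundE[OF h] by blast
  then have "g \<in> up R" using g(1,3) by (auto simp: up_iff intro!: exI[of _ b])
  then show "h \<in> (\<lambda>g n. (\<sigma> ^^ k) (g n)) ` up R" using g(2) by (auto intro!: image_eqI[of _ _ g])
qed

text \<open>The underlying groups coincide. Acting by \<open>g\<close> after the twist is acting by
  the polynomial with coefficients \<sigma>^k(g_n), since powers of \<sigma> commute; surjectivity
  makes these polynomials exhaust \<open>S\<close>.\<close>

lemma twist_embedding:
  assumes "\<sigma> ` carrier R = carrier R"
  shows "semilinear_embedding S (skew_poly_module (twist \<sigma> k M) \<sigma>) S Mx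
    (\<lambda>g n. (\<sigma> ^^ k) (g n)) id"
proof -
  interpret T: skew_module R "twist \<sigma> k M" \<sigma> by (rule twist_skew_module)
  show ?thesis
    using T.Mx_module Mx_module coefficientwise_surj[OF assms]
    by (auto simp: semilinear_embedding_def skew_poly_module_simps skew_poly_ring_simps(1)
        up_twist twist_simps finsum_twist sigma_pow_sigma_pow
        add.commute)
qed

lemma S_prime_twist_iff:
  assumes "\<sigma> ` carrier R = carrier R"
  shows "S_prime R \<sigma> (twist \<sigma> k M) \<longleftrightarrow> S_prime R \<sigma> M"
  unfolding S_prime_def semilinear_embedding_prime[OF twist_embedding[OF assms]]
  by (simp add: skew_poly_module_simps up_twist skew_poly_module_def)

lemma right_submodule_twist_iff:
  assumes "\<sigma> ` carrier R = carrier R"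
  shows "right_submodule N R (twist \<sigma> k M) \<longleftrightarrow> right_submodule N R M"
proof -
  have "additive_subgroup N (twist \<sigma> k M) \<longleftrightarrow> additive_subgroup N M"
    by (simp add: additive_subgroup_def twist_def)
  moreover have "(\<forall>r\<in>carrier R. m \<cdot>\<^bsub>M\<^esub> (\<sigma> ^^ k) r \<in> N) \<longleftrightarrow> (\<forall>r\<in>carrier R. m \<cdot>\<^bsub>M\<^esub> r \<in> N)" for m
    using sigma_pow_surj[OF assms, of k] by (metis (no_types, lifting) image_iff)
  ultimately show ?thesis by (simp add: right_submodule_def twist_simps)
qed

lemma Ass_Mx_surj:
  assumes surj: "\<sigma> ` carrier R = carrier R"
  shows "Ass S Mx = {skew_poly_ideal R (sigma_core R \<sigma> J) | J. J \<in> S_prime_annihilators R \<sigma> M}"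
proof -
  \<comment> \<open>The twist has the same submodules and the same \<open>S_prime\<close> ones among
    them; only their annihilators change, to preimages.\<close>
  have eq: "S_prime_annihilators R \<sigma> (twist \<sigma> k M) =
      pow_preimage R \<sigma> k ` S_prime_annihilators R \<sigma> M" for k
    using skew_module.S_prime_twist_iff[OF submodule_skew_module surj]
      skew_module.annihilator_twist[OF submodule_skew_module]
    unfolding S_prime_annihilators_def twist_submodule right_submodule_twist_iff[OF surj]
    by (auto simp: image_iff) metis+
  show ?thesis
    unfolding Ass_Mx eq using S_prime_annihilator_core by (auto simp: image_iff) metis+
qed

section \<open>Stability of cores and passage from prime to \<open>S_prime\<close> modules\<close>

lemma sigma_core_pow_preimage:
  "sigma_core R \<sigma> (pow_preimage R \<sigma> d X) = (\<Inter>n. pow_preimage R \<sigma> (n + d) X)"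
  by (auto simp: sigma_core_def pow_preimage_def sigma_pow_sigma_pow)

text \<open>An intersection of annihilators of twists of \<open>M\<close>, each of which is an
  ideal.\<close>

lemma sigma_core_ideal: "ideal (sigma_core R \<sigma> (pow_preimage R \<sigma> d (annihilator R M))) R"
  unfolding sigma_core_pow_preimage
proof (rule R.i_Intersect)
  fix I assume "I \<in> range (\<lambda>n. pow_preimage R \<sigma> (n + d) (annihilator R M))"
  then obtain n where "I = annihilator R (twist \<sigma> (n + d) M)"
    by (auto simp: annihilator_twist)
  then show "ideal I R"
    using right_module.annihilator_ideal skew_module.axioms(1)[OF twist_skew_module] by blast
qed auto

text \<open>The ideals \<open>\<sigma>\<^sup>-\<^sup>d((X : \<sigma>))\<close>, for \<open>X\<close> the annihilator, ascend with \<open>d\<close>.\<close>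

lemma sigma_core_stable:
  assumes acc: "acc_on_ideals R" and surj: "\<sigma> ` carrier R = carrier R"
    and r: "r \<in> carrier R"
    and mem: "\<And>j. (\<sigma> ^^ (j + d)) r \<in> annihilator R M"
  shows "r \<in> sigma_core R \<sigma> (annihilator R M)"
proof -
  define I where "I d = sigma_core R \<sigma> (pow_preimage R \<sigma> d (annihilator R M))" for d
  have I_iff: "s \<in> I d \<longleftrightarrow> s \<in> carrier R \<and> (\<forall>j. (\<sigma> ^^ (j + d)) s \<in> annihilator R M)" for s d
    unfolding I_def sigma_core_pow_preimage by (auto simp: pow_preimage_def)
  have "ideal (I n) R" for n unfolding I_def by (rule sigma_core_ideal)
  moreover have "I n \<subseteq> I (Suc n)" for n
  proof
    fix s assume s: "s \<in> I n"
    then have "(\<sigma> ^^ (Suc j + n)) s \<in> annihilator R M" for j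
      unfolding I_iff by blast
    then show "s \<in> I (Suc n)" using s by (simp add: I_iff del: funpow.simps)
  qed
  ultimately obtain N where N: "\<And>n. n \<ge> N \<Longrightarrow> I n = I N"
    using acc unfolding acc_on_ideals_def by meson
  \<comment> \<open>Lifting \<open>r\<close> along \<open>\<sigma> ^^ N\<close> moves the question
    into the stable range: the hypothesis puts \<open>s\<close> in \<open>I (d + N)\<close>, which
    equals \<open>I N\<close>, and that says that all \<sigma>^j(r) lie in the annihilator.\<close>
  have "r \<in> (\<sigma> ^^ N) ` carrier R" using sigma_pow_surj[OF surj] r by simp
  then obtain s where s: "s \<in> carrier R" "r = (\<sigma> ^^ N) s" by auto
  have pow: "(\<sigma> ^^ j) r = (\<sigma> ^^ (j + N)) s" for j using s(2) by (simp add: sigma_pow_sigma_pow add.commute)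
  have "s \<in> I (d + N)"
    using mem s(1) unfolding I_iff pow by (simp add: add.assoc)
  then have "s \<in> I N" using N[of "d + N"] by simp
  then show ?thesis
    using r by (auto simp: I_iff sigma_core_def pow_preimage_def pow)
qed

text \<open>Suppose \<open>f\<close> S \<open>g\<close> is zero with leading coefficient
  \<open>f d\<close>, and let \<open>g e\<close> be the last coefficient of \<open>g\<close> outside
  the core. Top degrees give \<open>f d\<close> R \<sigma>^(j+d)(g_e) = 0 for all \<open>j\<close>;
  primeness puts these powers in \<open>?P\<close>, and \<open>sigma_core_stable\<close> contradicts
  the choice of \<open>e\<close>.\<close>

lemma prime_imp_S_prime:
  assumes acc: "acc_on_ideals R" and surj: "\<sigma> ` carrier R = carrier R"
    and prime: "prime_module R M"
  shows "S_prime R \<sigma> M"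
proof -
  interpret Mx: right_module S Mx by (rule Mx_module)
  let ?P = "annihilator R M"
  have "g n \<in> sigma_core R \<sigma> ?P"
    if f: "f \<in> up M" "f \<noteq> \<zero>\<^bsub>Mx\<^esub>" and g: "g \<in> up R"
      and ann: "\<forall>s\<in>up R. f \<cdot>\<^bsub>Mx\<^esub> (s \<otimes>\<^bsub>S\<^esub> g) = \<zero>\<^bsub>Mx\<^esub>" for f g n
  proof (rule ccontr)
    assume n: "g n \<notin> sigma_core R \<sigma> ?P"
    obtain b where b: "\<And>n. n > b \<Longrightarrow> g n = \<zero>\<^bsub>R\<^esub>" using up_boundE[OF g] by blast
    have zP: "\<zero>\<^bsub>R\<^esub> \<in> sigma_core R \<sigma> ?P"
      by (auto simp: sigma_core_def pow_preimage_def annihilator_def sigma_pow_simps ract_zero)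
    \<comment> \<open>Coefficients of \<open>g\<close> beyond \<open>e\<close> may be nonzero, but
      they and their images under powers of \<sigma> annihilate \<open>M\<close>.\<close>
    obtain e where e: "g e \<notin> sigma_core R \<sigma> ?P" "\<And>n. n > e \<Longrightarrow> g n \<in> sigma_core R \<sigma> ?P"
    proof -
      have le: "n \<le> b" if "g n \<notin> sigma_core R \<sigma> ?P" for n
        using that b[of n] zP by (cases "n \<le> b") auto
      then obtain e where "g e \<notin> sigma_core R \<sigma> ?P"
        "\<And>n. g n \<notin> sigma_core R \<sigma> ?P \<Longrightarrow> n \<le> e"
        using Nat.ex_has_greatest_nat[of "\<lambda>n. g n \<notin> sigma_core R \<sigma> ?P" n b] n by auto
      then show thesis using that by (meson not_less)
    qed
    obtain a where a: "\<And>n. n > a \<Longrightarrow> f n = \<zero>\<^bsub>M\<^esub>" using up_boundE[OF f(1)] by blast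
    obtain d where d: "f d \<noteq> \<zero>\<^bsub>M\<^esub>" "\<And>n. n > d \<Longrightarrow> f n = \<zero>\<^bsub>M\<^esub>"
    proof -
      obtain n where "f n \<noteq> \<zero>\<^bsub>M\<^esub>" using f(2) by (auto simp: skew_poly_module_simps)
      moreover have "n \<le> a" if "f n \<noteq> \<zero>\<^bsub>M\<^esub>" for n
        using that a[of n] by (cases "n \<le> a") auto
      ultimately obtain d where "f d \<noteq> \<zero>\<^bsub>M\<^esub>" "\<And>n. f n \<noteq> \<zero>\<^bsub>M\<^esub> \<Longrightarrow> n \<le> d"
        using Nat.ex_has_greatest_nat[of "\<lambda>n. f n \<noteq> \<zero>\<^bsub>M\<^esub>" n a] by auto
      then show thesis using that by (meson not_less)
    qed
    have "(\<sigma> ^^ (j + d)) (g e) \<in> ?P" for j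
    proof -
      have top: "f d \<cdot>\<^bsub>M\<^esub> (\<sigma> ^^ d) r \<cdot>\<^bsub>M\<^esub> (\<sigma> ^^ (j + d)) (g e) = \<zero>\<^bsub>M\<^esub>" if r: "r \<in> carrier R" for r
      proof -
        \<comment> \<open>The multiplier r x^j raises the power of \<sigma> applied to
          \<open>g e\<close> from \<open>d\<close> to \<open>d + j\<close>, so all powers from
          \<open>d\<close> on are reached.\<close>
        let ?s = "\<lambda>i. if i = j then r else \<zero>\<^bsub>R\<^esub>"
        define p where "p = f \<cdot>\<^bsub>Mx\<^esub> ?s"
        have s: "?s \<in> up R" using r by (auto simp: up_iff intro!: exI[of _ j])
        have p: "p \<in> up M" unfolding p_def by (rule skew_ract_closed[OF f(1) s])
        have p_top: "p (d + j) = f d \<cdot>\<^bsub>M\<^esub> (\<sigma> ^^ d) r"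
        proof -
          have "p (d + j) = f d \<cdot>\<^bsub>M\<^esub> (\<sigma> ^^ d) (?s (d + j - d))"
            unfolding p_def skew_poly_module_simps using f(1) r
            by (intro M.finsum_single) (auto simp: sigma_pow_simps ract_closed ract_zero)
          then show ?thesis by simp
        qed
        have p_above: "p i = \<zero>\<^bsub>M\<^esub>" if "i > d + j" for i
          unfolding p_def skew_poly_module_simps using f(1) r that d(2)
          by (intro M.add.finprod_one_eqI) (auto simp: sigma_pow_simps ract_zero zero_ract)
        \<comment> \<open>Coefficients of \<open>p\<close> above \<open>d + j\<close> vanish, and
          those below meet coefficients of \<open>g\<close> beyond \<open>e\<close>. Only the term
          at \<open>d + j\<close> is left.\<close>
        have "(p \<cdot>\<^bsub>Mx\<^esub> g) (d + j + e) =
            p (d + j) \<cdot>\<^bsub>M\<^esub> (\<sigma> ^^ (d + j)) (g (d + j + e - (d + j)))"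
          unfolding skew_poly_module_simps
        proof (rule M.finsum_single)
          fix i assume i: "i \<le> d + j + e" "i \<noteq> d + j"
          show "p i \<cdot>\<^bsub>M\<^esub> (\<sigma> ^^ i) (g (d + j + e - i)) = \<zero>\<^bsub>M\<^esub>"
          proof (cases "i > d + j")
            case True
            then show ?thesis using g p_above by (simp add: zero_ract)
          next
            case False
            then have "g (d + j + e - i) \<in> sigma_core R \<sigma> ?P" using i by (intro e(2)) auto
            then show ?thesis
              using p by (auto simp: sigma_core_def pow_preimage_def annihilator_def)
          qed
        qed (use g p in \<open>auto intro: ract_closed\<close>)
        moreover have "p \<cdot>\<^bsub>Mx\<^esub> g = \<zero>\<^bsub>Mx\<^esub>"
          using ann s skew_ract_assoc[OF f(1) s g] by (simp add: p_def)
        ultimately show ?thesis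
          by (simp add: p_top skew_poly_module_simps(2) add.commute[of j])
      qed
      \<comment> \<open>As \<open>\<sigma> ^^ d\<close> is onto, its values on \<open>r\<close> in
        \<open>top\<close> run through the whole ring, as the criterion for primeness
        demands.\<close>
      have "f d \<cdot>\<^bsub>M\<^esub> (t \<otimes>\<^bsub>R\<^esub> (\<sigma> ^^ (j + d)) (g e)) = \<zero>\<^bsub>M\<^esub>" if "t \<in> carrier R" for t
      proof -
        have "t \<in> (\<sigma> ^^ d) ` carrier R" using sigma_pow_surj[OF surj] that by simp
        then show ?thesis using top f(1) g by (auto simp: ract_assoc)
      qed
      then show ?thesis
        using prime f(1) d(1) g unfolding prime_module_iff by auto
    qed
    then have "g e \<in> sigma_core R \<sigma> ?P"
      using g by (intro sigma_core_stable[OF acc surj]) auto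
    then show False using e(1) by simp
  qed
  moreover have "up M \<noteq> {\<zero>\<^bsub>Mx\<^esub>}"
    using prime up_trivial_iff by (simp add: prime_module_def skew_poly_module_simps)
  ultimately show ?thesis
    unfolding S_prime_def Mx.prime_module_iff annihilator_Mx
    by (auto simp: skew_poly_module_simps(1) skew_poly_ring_simps(1) skew_poly_ideal_def)
qed

text \<open>Prime submodules are \<open>S_prime\<close> by \<open>prime_imp_S_prime\<close>.
  Conversely, an \<open>S_prime\<close> submodule \<open>L\<close> contains a prime
  \<open>N\<close>, whose annihilator may be larger; the module induced from \<open>N\<close> is a
  nonzero submodule of the prime one induced from \<open>L\<close>, so the induced annihilators
  agree all the same.\<close>

lemma Ass_Mx_acc:
  assumes acc: "acc_on_ideals R" and surj: "\<sigma> ` carrier R = carrier R"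
  shows "Ass S Mx = {skew_poly_ideal R (sigma_core R \<sigma> P) | P. P \<in> Ass R M}"
  unfolding Ass_Mx_surj[OF surj]
proof (intro equalityI subsetI)
  fix Q assume "Q \<in> {skew_poly_ideal R (sigma_core R \<sigma> P) | P. P \<in> Ass R M}"
  then obtain N where N: "right_submodule N R M" "prime_module R (M\<lparr>carrier := N\<rparr>)"
    and Q: "Q = skew_poly_ideal R (sigma_core R \<sigma> (annihilator R (M\<lparr>carrier := N\<rparr>)))"
    by (auto simp: Ass_def)
  have "S_prime R \<sigma> (M\<lparr>carrier := N\<rparr>)"
    by (rule skew_module.prime_imp_S_prime[OF submodule_skew_module[OF N(1)] acc surj N(2)])
  with N(1) show "Q \<in> {skew_poly_ideal R (sigma_core R \<sigma> J) | J. J \<in> S_prime_annihilators R \<sigma> M}"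
    unfolding Q S_prime_annihilators_def by blast
next
  fix Q assume "Q \<in> {skew_poly_ideal R (sigma_core R \<sigma> J) | J. J \<in> S_prime_annihilators R \<sigma> M}"
  then obtain L where L: "right_submodule L R M" "S_prime R \<sigma> (M\<lparr>carrier := L\<rparr>)"
    and Q: "Q = skew_poly_ideal R (sigma_core R \<sigma> (annihilator R (M\<lparr>carrier := L\<rparr>)))"
    by (auto simp: S_prime_annihilators_def)
  interpret L: skew_module R "M\<lparr>carrier := L\<rparr>" \<sigma> by (rule submodule_skew_module[OF L(1)])
  have "carrier (M\<lparr>carrier := L\<rparr>) \<noteq> {\<zero>\<^bsub>M\<lparr>carrier := L\<rparr>\<^esub>}"
    using L(2) L.up_trivial_iff by (auto simp: S_prime_def prime_module_def skew_poly_module_simps)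
  from L.prime_submodule_exists[OF acc this] obtain N where
    NL: "right_submodule N R (M\<lparr>carrier := L\<rparr>)" and nz: "N \<noteq> {\<zero>\<^bsub>M\<^esub>}"
    and prime: "prime_module R (M\<lparr>carrier := N\<rparr>)" by auto
  interpret N: skew_module R "M\<lparr>carrier := N\<rparr>" \<sigma>
    using L.submodule_skew_module[OF NL] by simp
  have "annihilator S N.Mx = annihilator S L.Mx"
    using L.inclusion_embedding[OF NL] L(2) nz N.up_trivial_iff
    by (intro embedding_prime(2)) (auto simp: S_prime_def skew_poly_module_simps)
  then have "Q = skew_poly_ideal R (sigma_core R \<sigma> (annihilator R (M\<lparr>carrier := N\<rparr>)))"
    by (simp add: Q L.annihilator_Mx N.annihilator_Mx)
  with right_submodule_trans[OF L(1) NL] prime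
  show "Q \<in> {skew_poly_ideal R (sigma_core R \<sigma> P) | P. P \<in> Ass R M}"
    unfolding Ass_def by blast
qed

end

theorem proposition5p8:
  fixes R :: "('a, 'c) ring_scheme"
    and M :: "('a, 'b, 'm) right_module_scheme"
    and \<sigma> :: "'a \<Rightarrow> 'a"
  assumes "ring R"
    and "\<sigma> \<in> ring_hom R R"
    and "right_module R M"
  shows "(Ass (skew_poly_ring R \<sigma>) (skew_poly_module M \<sigma>) =
           {skew_poly_ideal R (sigma_core R \<sigma> (pow_preimage R \<sigma> k J)) | k J.
              J \<in> S_prime_annihilators R \<sigma> (twist \<sigma> k M)}) \<and>
         (\<sigma> ` carrier R = carrier R \<longrightarrow>
           Ass (skew_poly_ring R \<sigma>) (skew_poly_module M \<sigma>) =
             {skew_poly_ideal R (sigma_core R \<sigma> J) | J. J \<in> S_prime_annihilators R \<sigma> M}) \<and>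
         (acc_on_ideals R \<and> \<sigma> \<in> ring_iso R R \<longrightarrow>
           Ass (skew_poly_ring R \<sigma>) (skew_poly_module M \<sigma>) =
             {skew_poly_ideal R (sigma_core R \<sigma> P) | P. P \<in> Ass R M})"
proof -
  interpret skew_module R M \<sigma>
    using assms by (intro skew_module.intro skew_module_axioms.intro)
  have "\<sigma> ` carrier R = carrier R" if "\<sigma> \<in> ring_iso R R"
    using that by (simp add: ring_iso_def bij_betw_def)
  then show ?thesis
    using Ass_Mx_preimage Ass_Mx_surj Ass_Mx_acc by blast
qed

end
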